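(* For every integer $m\ge1$, \[ \triangle(q)^{4m^2+4m}=\frac{1}{2^m(m!)^2\left(\prod_{i=1}^m(2i-1)!\right)^2}\sum_{J\subset\{1,\dots,m\}}(-1)^{|J|}\sum_{\vec k,\vec r\in\mathbb{Z}^m_J}q^{\sum_{j=1}^m(2k_jr_j-r_j)-\frac{m(m+1)}{2}}\prod_{i=1}^m r_i^3\prod_{1\le i<j\le m}(r_i-r_j)^2(r_i+r_j)^2. \]
   Context: $\triangle(q)=\sum_{n\ge0}q^{n(n+1)/2}$. For $J\subset\{1,\dots,m\}$, $\mathbb{Z}^m_J=\{\vec k=(k_1,\dots,k_m)\in\mathbb{Z}^m : J=\{j: k_j\le 0\}\}$; the inner sum is over pairs $\vec k=(k_1,\dots,k_m)$, $\vec r=(r_1,\dots,r_m)$ both in $\mathbb{Z}^m_J$. *)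

theory Defs
  imports "HOL-Analysis.Analysis"
begin

definition triangle_series :: "complex \<Rightarrow> complex" where
  "triangle_series q = (\<Sum>n. q ^ (n * (n + 1) div 2))"

text \<open>Vectors in \<open>\<int>\<^sup>m\<close> are extensional functions on \<open>{1..m}\<close>, so that each vector has exactly
  one representative.\<close>

definition int_vecs :: "nat \<Rightarrow> nat set \<Rightarrow> (nat \<Rightarrow> int) set" where
  "int_vecs m J = {k \<in> {1..m} \<rightarrow>\<^sub>E UNIV. J = {j \<in> {1..m}. k j \<le> 0}}"

text \<open>The integer exponent of \<open>q\<close> can be negative, but only if some \<open>r\<^sub>i\<close> vanishes or
  \<open>r\<^sub>i = \<plusminus>r\<^sub>j\<close> for some \<open>i \<noteq> j\<close>; the coefficient is then \<open>0\<close>.  Hence the term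
  has its intended value also at \<open>q = 0\<close>, where \<open>powi\<close> with a negative exponent gives \<open>0\<close>.\<close>

definition kr_term :: "nat \<Rightarrow> complex \<Rightarrow> (nat \<Rightarrow> int) \<Rightarrow> (nat \<Rightarrow> int) \<Rightarrow> complex" where
  "kr_term m q k r =
     q powi ((\<Sum>j=1..m. 2 * k j * r j - r j) - int (m * (m + 1) div 2)) *
     of_int ((\<Prod>i=1..m. r i ^ 3) *
             (\<Prod>(i, j)\<in>{(i, j). 1 \<le> i \<and> i < j \<and> j \<le> m}. (r i - r j)\<^sup>2 * (r i + r j)\<^sup>2))"

end

theory Submission
  imports Defs "HOL-Computational_Algebra.Formal_Power_Series" "Jordan_Normal_Form.Determinant"
begin

text \<open>
  Put \<open>q = Q\<^sup>2\<close>. Reflecting \<open>(k\<^sub>j, r\<^sub>j) \<mapsto> (1 - k\<^sub>j, - r\<^sub>j)\<close> and expanding the squared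
  Vandermonde product turn the right-hand side into \<open>m!\<close> times the Hankel determinant of the
  Lambert series \<open>S\<^sub>n = \<Sum> r\<^bsup>2n+1\<^esup> / (q\<^bsup>-r\<^esup> - q\<^bsup>r\<^esup>)\<close>. The numbers \<open>2 S\<^sub>n\<close> are the even
  derivatives at \<open>0\<close> of the square \<open>\<phi>\<close> of the Fourier series
  \<open>\<Sum> exp (n x / 2) / (Q\<^bsup>-n\<^esup> - Q\<^bsup>n\<^esup>)\<close> over odd \<open>n\<close>, essentially the Jacobi function \<open>sn\<^sup>2\<close>. Convolving
  Fourier coefficients with the addition theorem of the hyperbolic cotangent gives
  \<open>\<phi>'\<^sup>2 = 4 \<phi>\<^sup>3 + a \<phi>\<^sup>2 + 4 c \<phi>\<close>. Hence the second derivative acts on the powers of \<open>\<phi>\<close> as a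
  tridiagonal matrix, and the Hankel matrix is a product of two triangular matrices with explicit
  diagonals; its determinant is a multiple of \<open>c\<^bsup>m(m+1)/2\<^esup>\<close>. Finally \<open>c = q \<triangle>(q)\<^sup>8\<close>
  follows from the Lambert series of the square of the theta function \<open>\<Sum> q\<^bsup>n\<^sup>2\<^esup>\<close>, which is proved
  by iterating \<open>q \<mapsto> - q\<^sup>2\<close>. The case \<open>q = 0\<close> follows by continuity.
\<close>

section \<open>Two-sided series and their convolution\<close>

text \<open>The addition theorem computes the convolution of two coefficient sequences at every
  frequency except 0, so each product of Fourier series is known only up to an additive constant.
  These constants are never evaluated one by one. The series with coefficients 1 / (Q^-n + Q^n)
  splits into its even- and odd-frequency parts V and W, which up to scaling are dn and cn with nome
  q = Q^2, while the odd series Y plays the role of sn: Y' = V W, V^2 = Y^2 + V(0)^2 and W^2 = Y^2 +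
  W(0)^2, because Y(0) = 0. Hence \<phi> = Y^2 satisfies \<phi>'^2 = 4 \<phi> (\<phi> + V(0)^2)
  (\<phi> + W(0)^2), and c = (V(0) W(0))^2. The value V(0) W(0) is a quarter of the difference of
  the squares of two Lambert series, each of them half of a squared theta value; Jacobi's quartic
  identity evaluates it as Q times the fourth power of the triangle series. The factor q in c
  cancels the prefactor q^(-m(m+1)/2), and the eighth power of the triangle series, raised to
  m(m+1)/2, is the exponent 4m^2 + 4m.\<close>

no_notation Infinite_Set_Sum.abs_summable_on (infix "abs'_summable'_on" 50)

text \<open>Two-sided geometric decay survives bounded and polynomial factors, so one hypothesis
  covers the absolute summability of a Fourier series and of all its termwise derivatives.\<close>

definition geo_bounded :: "(int \<Rightarrow> complex) \<Rightarrow> bool" where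
  "geo_bounded f \<longleftrightarrow> (\<exists>C x. 0 \<le> x \<and> x < 1 \<and> (\<forall>n. norm (f n) \<le> C * x ^ nat \<bar>n\<bar>))"

lemma geo_boundedI:
  assumes "0 \<le> x" "x < 1" "\<And>n. norm (f n) \<le> C * x ^ nat \<bar>n\<bar>"
  shows "geo_bounded f"
  using assms unfolding geo_bounded_def by blast

lemma summable_on_int_geometric:
  fixes x :: real
  assumes "0 \<le> x" "x < 1"
  shows "(\<lambda>n::int. x ^ nat \<bar>n\<bar>) summable_on UNIV"
proof -
  have s: "(\<lambda>n::nat. x ^ n) summable_on UNIV"
    using assms by (simp add: summable_on_UNIV_nonneg_real_iff summable_geometric)
  have 1: "(\<lambda>n::int. x ^ nat \<bar>n\<bar>) summable_on range int"
    by (subst summable_on_reindex) (use s in \<open>auto simp: o_def\<close>)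
  have 2: "(\<lambda>n::int. x ^ nat \<bar>n\<bar>) summable_on range (\<lambda>n. - int n)"
    by (subst summable_on_reindex) (use s in \<open>auto simp: o_def inj_def\<close>)
  have "UNIV = range int \<union> range (\<lambda>n. - int n)"
    by (auto simp: image_iff) (metis int_cases2)
  with summable_on_union[OF 1 2] show ?thesis by simp
qed

lemma geo_bounded_abs_summable:
  assumes "geo_bounded f"
  shows "f abs_summable_on UNIV"
proof -
  obtain C x where Cx: "0 \<le> x" "x < 1" "\<And>n. norm (f n) \<le> C * x ^ nat \<bar>n\<bar>"
    using assms unfolding geo_bounded_def by blast
  have "(\<lambda>n::int. C * x ^ nat \<bar>n\<bar>) summable_on UNIV"
    by (intro summable_on_cmult_right summable_on_int_geometric Cx)
  thus ?thesis
    by (rule summable_on_comparison_test) (use Cx in auto)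
qed

lemma geo_bounded_summable: "geo_bounded f \<Longrightarrow> f summable_on UNIV"
  using abs_summable_summable geo_bounded_abs_summable by blast

lemma geo_bounded_bounded_mult:
  assumes "geo_bounded f" "\<And>n. norm (b n) \<le> B"
  shows "geo_bounded (\<lambda>n. b n * f n)"
proof -
  obtain C x where Cx: "0 \<le> x" "x < 1" "\<And>n. norm (f n) \<le> C * x ^ nat \<bar>n\<bar>"
    using assms unfolding geo_bounded_def by blast
  have "norm (b n * f n) \<le> (B * C) * x ^ nat \<bar>n\<bar>" for n
    using mult_mono[OF assms(2)[of n] Cx(3)[of n]] order_trans[OF norm_ge_zero assms(2)]
    by (simp add: norm_mult mult.assoc)
  with Cx show ?thesis by (intro geo_boundedI[of x _ "B * C"]) auto
qed

text \<open>Each of the \<open>n\<close> copies of \<open>y ^ n\<close> is at most one of the powers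
  with exponent below \<open>n\<close>, and these sum to at most the full geometric series.\<close>

lemma nat_mult_power_le:
  fixes y :: real
  assumes "0 \<le> y" "y < 1"
  shows "of_nat n * y ^ n \<le> 1 / (1 - y)"
proof -
  have "of_nat n * y ^ n = (\<Sum>i<n. y ^ n)" by simp
  also have "\<dots> \<le> (\<Sum>i<n. y ^ i)"
    by (intro sum_mono power_decreasing) (use assms in auto)
  also have "\<dots> = (1 - y ^ n) / (1 - y)"
    using assms by (simp add: sum_gp_strict)
  also have "\<dots> \<le> 1 / (1 - y)"
    using assms by (intro divide_right_mono) auto
  finally show ?thesis .
qed

lemma geo_bounded_int_mult:
  assumes "geo_bounded f"
  shows "geo_bounded (\<lambda>n. of_int n * f n)"
proof -
  obtain C x where Cx: "0 \<le> x" "x < 1" "\<And>n. norm (f n) \<le> C * x ^ nat \<bar>n\<bar>"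
    using assms unfolding geo_bounded_def by blast
  \<comment> \<open>One of the two factors \<open>y ^ n\<close> of \<open>x ^ n\<close> absorbs the
    factor \<open>n\<close>; the other remains as the new geometric rate.\<close>
  define y where "y = sqrt x"
  have y: "0 \<le> y" "y < 1" "x = y * y" using Cx by (auto simp: y_def)
  have C: "0 \<le> C" using Cx(3)[of 0] order_trans[OF norm_ge_zero] by fastforce
  have le: "norm (of_int n * f n) \<le> (C / (1 - y)) * y ^ nat \<bar>n\<bar>" for n
  proof -
    have "norm (of_int n * f n) = real (nat \<bar>n\<bar>) * norm (f n)"
      by (simp add: norm_mult)
    also have "\<dots> \<le> real (nat \<bar>n\<bar>) * (C * x ^ nat \<bar>n\<bar>)"
      by (intro mult_left_mono Cx) auto
    also have "\<dots> = C * (real (nat \<bar>n\<bar>) * y ^ nat \<bar>n\<bar>) * y ^ nat \<bar>n\<bar>"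
      by (simp add: y(3) power_mult_distrib)
    also have "\<dots> \<le> C * (1 / (1 - y)) * y ^ nat \<bar>n\<bar>"
      by (intro mult_right_mono mult_left_mono nat_mult_power_le) (use y C in auto)
    finally show ?thesis by simp
  qed
  show ?thesis by (rule geo_boundedI[OF y(1,2) le])
qed

lemma geo_bounded_int_power_mult:
  "geo_bounded f \<Longrightarrow> geo_bounded (\<lambda>n. of_int n ^ k * f n)"
proof (induction k)
  case (Suc k)
  from geo_bounded_int_mult[OF Suc.IH[OF Suc.prems]] show ?case by (simp add: mult.assoc)
qed simp

lemma abs_summable_times:
  fixes f :: "'a \<Rightarrow> complex" and g :: "'b \<Rightarrow> complex"
  assumes "f abs_summable_on A" "g abs_summable_on B"
  shows "(\<lambda>(x, y). f x * g y) abs_summable_on A \<times> B"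
proof (subst Infinite_Sum.abs_summable_on_Sigma_iff, intro conjI ballI)
  show "(\<lambda>y. case (x, y) of (x, y) \<Rightarrow> f x * g y) abs_summable_on B" for x
    unfolding prod.case norm_mult by (rule summable_on_cmult_right[OF assms(2)])
  show "(\<lambda>x. \<Sum>\<^sub>\<infinity>y\<in>B. norm (case (x, y) of (x, y) \<Rightarrow> f x * g y)) abs_summable_on A"
    unfolding prod.case norm_mult infsum_cmult_right' real_norm_def abs_mult abs_norm_cancel
    by (rule summable_on_cmult_left[OF assms(1)])
qed

lemma infsum_times:
  fixes f :: "'a \<Rightarrow> complex" and g :: "'b \<Rightarrow> complex"
  assumes "f abs_summable_on A" "g abs_summable_on B"
  shows "infsum f A * infsum g B = (\<Sum>\<^sub>\<infinity>(x, y)\<in>A \<times> B. f x * g y)"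
proof -
  have "(\<Sum>\<^sub>\<infinity>x\<in>A. \<Sum>\<^sub>\<infinity>y\<in>B. f x * g y) = (\<Sum>\<^sub>\<infinity>(x, y)\<in>A \<times> B. f x * g y)"
    by (rule infsum_Sigma'_banach[OF abs_summable_summable[OF abs_summable_times[OF assms]]])
  thus ?thesis by (simp add: infsum_cmult_right' infsum_cmult_left')
qed

lemma infsum_sum:
  fixes f :: "'i \<Rightarrow> 'a \<Rightarrow> complex"
  assumes "finite I" "\<And>i. i \<in> I \<Longrightarrow> f i abs_summable_on A"
  shows "(\<lambda>x. \<Sum>i\<in>I. f i x) abs_summable_on A"
    and "(\<Sum>\<^sub>\<infinity>x\<in>A. \<Sum>i\<in>I. f i x) = (\<Sum>i\<in>I. infsum (f i) A)"
proof -
  have "(\<lambda>x. \<Sum>i\<in>I. f i x) abs_summable_on A \<and>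
        (\<Sum>\<^sub>\<infinity>x\<in>A. \<Sum>i\<in>I. f i x) = (\<Sum>i\<in>I. infsum (f i) A)"
    using assms
  proof (induction rule: finite_induct)
    case (insert i I)
    have IH: "(\<lambda>x. \<Sum>i\<in>I. f i x) abs_summable_on A"
      "(\<Sum>\<^sub>\<infinity>x\<in>A. \<Sum>i\<in>I. f i x) = (\<Sum>i\<in>I. infsum (f i) A)"
      using insert by auto
    have fi: "f i abs_summable_on A" using insert by simp
    have "(\<lambda>x. norm (f i x) + norm (\<Sum>i\<in>I. f i x)) summable_on A"
      by (intro summable_on_add fi IH)
    hence "(\<lambda>x. f i x + (\<Sum>i\<in>I. f i x)) abs_summable_on A"
      by (rule summable_on_comparison_test) (auto intro: norm_triangle_ineq)
    moreover have "(\<Sum>\<^sub>\<infinity>x\<in>A. f i x + (\<Sum>i\<in>I. f i x)) = infsum (f i) A + (\<Sum>\<^sub>\<infinity>x\<in>A. \<Sum>i\<in>I. f i x)"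
      by (rule infsum_add[OF abs_summable_summable[OF fi] abs_summable_summable[OF IH(1)]])
    ultimately show ?case using insert.hyps by (simp add: IH)
  qed auto
  thus "(\<lambda>x. \<Sum>i\<in>I. f i x) abs_summable_on A"
    and "(\<Sum>\<^sub>\<infinity>x\<in>A. \<Sum>i\<in>I. f i x) = (\<Sum>i\<in>I. infsum (f i) A)" by auto
qed

definition conv :: "(int \<Rightarrow> complex) \<Rightarrow> (int \<Rightarrow> complex) \<Rightarrow> int \<Rightarrow> complex" where
  "conv f g r = (\<Sum>\<^sub>\<infinity>s. f s * g (r - s))"

lemma bij_int_pair_add: "bij_betw (\<lambda>(r, s). (s, r - s :: int)) UNIV UNIV"
  by (rule bij_betwI[of _ _ _ "\<lambda>(s, t). (s + t, s)"]) auto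

text \<open>The weight depends only on \<open>s + t\<close>, so summing along the diagonals first
  pulls it out. Weight 1 gives products of plain sums; Taylor coefficients of exponentials give
  products of power series.\<close>

lemma infsum_weighted_conv:
  assumes "(\<lambda>(s, t). w (s + t) * (f s * g t)) abs_summable_on (UNIV :: (int \<times> int) set)"
  shows "(\<Sum>\<^sub>\<infinity>(s, t). w (s + t) * (f s * g t)) = (\<Sum>\<^sub>\<infinity>r. w r * conv f g r)"
proof -
  have s: "(\<lambda>(s, t). w (s + t) * (f s * g t)) summable_on (UNIV :: (int \<times> int) set)"
    by (rule abs_summable_summable[OF assms])
  have "(\<Sum>\<^sub>\<infinity>(s, t). w (s + t) * (f s * g t)) = (\<Sum>\<^sub>\<infinity>(r, s). w r * (f s * g (r - s)))"
    by (subst infsum_reindex_bij_betw[OF bij_int_pair_add, symmetric])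
       (simp add: case_prod_unfold)
  also have "\<dots> = (\<Sum>\<^sub>\<infinity>r. \<Sum>\<^sub>\<infinity>s. w r * (f s * g (r - s)))"
  proof (subst infsum_Sigma'_banach[where A = UNIV and B = "\<lambda>_. UNIV"])
    show "(\<lambda>(r, s). w r * (f s * g (r - s))) summable_on UNIV \<times> UNIV"
      using s by (subst (asm) summable_on_reindex_bij_betw[OF bij_int_pair_add, symmetric])
       (simp add: case_prod_unfold)
  qed simp
  finally show ?thesis by (simp add: conv_def infsum_cmult_right')
qed

lemma infsum_conv:
  assumes "geo_bounded f" "geo_bounded g"
  shows "infsum f UNIV * infsum g UNIV = infsum (conv f g) UNIV"
  using infsum_weighted_conv[of "\<lambda>_. 1" f g] abs_summable_times[of f UNIV g UNIV]
    infsum_times[of f UNIV g UNIV] assms geo_bounded_abs_summable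
  by simp

text \<open>The Taylor expansion in \<open>x\<close> of the Fourier series \<open>\<Sum> f n * exp (n * x / 2)\<close>.\<close>

definition fourier_fps :: "(int \<Rightarrow> complex) \<Rightarrow> complex fps" where
  "fourier_fps f = Abs_fps (\<lambda>k. \<Sum>\<^sub>\<infinity>n. fps_nth (fps_exp (of_int n / 2)) k * f n)"

lemma geo_bounded_fps_exp_mult:
  assumes "geo_bounded f"
  shows "geo_bounded (\<lambda>n. fps_nth (fps_exp (of_int n / 2)) k * f n)"
proof -
  have "(\<lambda>n. fps_nth (fps_exp (of_int n / 2)) k * f n) =
        (\<lambda>n. (1 / (2 ^ k * fact k)) * (of_int n ^ k * f n))"
    by (simp add: power_divide)
  thus ?thesis
    using geo_bounded_bounded_mult[OF geo_bounded_int_power_mult[OF assms, of k],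
       of "\<lambda>_. 1 / (2 ^ k * fact k)" "norm (1 / (2 ^ k * fact k) :: complex)"] by simp
qed

text \<open>The Taylor coefficients of a product of two exponentials form a Cauchy product. The
  comparison is made coefficient by coefficient, so no convergence in the formal variable is
  involved.\<close>

lemma fourier_fps_mult:
  assumes "geo_bounded f" "geo_bounded g"
  shows "fourier_fps f * fourier_fps g = fourier_fps (conv f g)"
proof (rule fps_ext)
  fix k
  define e where "e = (\<lambda>n k. fps_nth (fps_exp (of_int n / 2 :: complex)) k)"
  have ab: "(\<lambda>n. e n i * f n) abs_summable_on UNIV" "(\<lambda>n. e n i * g n) abs_summable_on UNIV" for i
    unfolding e_def by (intro geo_bounded_abs_summable geo_bounded_fps_exp_mult assms)+
  have ab2: "(\<lambda>(s, t). (e s i * f s) * (e t j * g t)) abs_summable_on UNIV" for i j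
    using abs_summable_times[OF ab(1)[of i] ab(2)[of j]] by simp
  have e_add: "e (s + t) k = (\<Sum>i=0..k. e s i * e t (k - i))" for s t :: int
  proof -
    have "fps_exp (of_int (s + t) / 2 :: complex) = fps_exp (of_int s / 2) * fps_exp (of_int t / 2)"
      by (simp add: fps_exp_add_mult [symmetric] add_divide_distrib)
    thus ?thesis by (simp only: fps_mult_nth e_def)
  qed
  have eq: "(\<lambda>(s, t). e (s + t) k * (f s * g t)) =
      (\<lambda>x. \<Sum>i=0..k. (\<lambda>(s, t). (e s i * f s) * (e t (k - i) * g t)) x)"
    unfolding e_add case_prod_unfold sum_distrib_right by (simp only: mult_ac)
  have "fps_nth (fourier_fps f * fourier_fps g) k =
        (\<Sum>i=0..k. (\<Sum>\<^sub>\<infinity>n. e n i * f n) * (\<Sum>\<^sub>\<infinity>n. e n (k - i) * g n))"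
    by (simp only: fourier_fps_def e_def fps_mult_nth fps_nth_Abs_fps)
  also have "\<dots> = (\<Sum>i=0..k. (\<Sum>\<^sub>\<infinity>(s, t). (e s i * f s) * (e t (k - i) * g t)))"
    by (simp add: infsum_times[OF ab])
  also have "\<dots> = (\<Sum>\<^sub>\<infinity>x. (\<Sum>i=0..k. (\<lambda>(s, t). (e s i * f s) * (e t (k - i) * g t)) x))"
    by (rule infsum_sum(2) [symmetric]) (simp, rule ab2)
  also have "\<dots> = (\<Sum>\<^sub>\<infinity>(s, t). e (s + t) k * (f s * g t))"
    unfolding eq ..
  also have "\<dots> = (\<Sum>\<^sub>\<infinity>r. e r k * conv f g r)"
  proof (rule infsum_weighted_conv)
    show "(\<lambda>(s, t). e (s + t) k * (f s * g t)) abs_summable_on UNIV"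
      unfolding eq by (rule infsum_sum(1)) (simp, rule ab2)
  qed
  finally show "fps_nth (fourier_fps f * fourier_fps g) k = fps_nth (fourier_fps (conv f g)) k"
    by (simp only: fourier_fps_def e_def fps_nth_Abs_fps)
qed

section \<open>Convolution of the Fourier coefficients\<close>

text \<open>Up to a factor 2 the values \<open>d = 1\<close> and \<open>d = -1\<close> are
  hyperbolic sine and cosine; the parameter lets one addition theorem serve both. For
  \<open>d = 1\<close> the value at \<open>n = 0\<close> is 0, so that quotients by it are 0
  there.\<close>

definition den :: "complex \<Rightarrow> complex \<Rightarrow> int \<Rightarrow> complex" where
  "den d Q n = Q powi (- n) - d * Q powi n"

lemma norm_powi_lt_1:
  fixes Q :: complex
  assumes "Q \<noteq> 0" "norm Q < 1" "n > 0"
  shows "norm (Q powi n) < 1"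
  using assms power_Suc_less_one[of "norm Q" "nat n - 1"]
  by (simp add: power_int_def norm_power flip: power_Suc)

text \<open>With \<open>x = norm Q ^ nat \<bar>n\<bar>\<close> the reverse triangle inequality
  bounds the denominator below by \<open>inverse x - x\<close>, and
  \<open>x * x \<le> norm Q\<close>. At \<open>n = 0\<close> with \<open>d = 1\<close> the bound
  holds because \<open>1 / 0 = 0\<close>.\<close>

lemma norm_inverse_den_le:
  assumes Q: "Q \<noteq> 0" "norm Q < 1" and d: "d \<in> {1, -1}"
  shows "norm (1 / den d Q n) \<le> 1 / (1 - norm Q) * norm Q ^ nat \<bar>n\<bar>"
proof (cases "n = 0")
  case True
  have "norm (1 / den d Q n) \<le> 1"
    using True d by (auto simp: den_def)
  also have "1 \<le> 1 / (1 - norm Q)" using Q by simp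
  finally show ?thesis using True by simp
next
  case False
  define x where "x = norm Q ^ nat \<bar>n\<bar>"
  have x: "0 < x" "x \<le> norm Q" 
    using Q False power_decreasing[of 1 "nat \<bar>n\<bar>" "norm Q"] by (auto simp: x_def)
  have "inverse x - x \<le> norm (den d Q n)"
  proof (cases "n > 0")
    case True
    have "norm (Q powi (- n)) = inverse x" "norm (d * Q powi n) = x"
      using d True by (auto simp: x_def norm_mult norm_power_int power_int_def norm_inverse norm_power power_inverse)
    thus ?thesis unfolding den_def using norm_triangle_ineq2[of "Q powi (-n)" "d * Q powi n"] by simp
  next
    case False
    hence "norm (Q powi (- n)) = x" "norm (d * Q powi n) = inverse x"
      using d \<open>n \<noteq> 0\<close> by (auto simp: x_def norm_mult norm_power_int power_int_def norm_inverse norm_power power_inverse)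
    thus ?thesis unfolding den_def using norm_triangle_ineq3[of "Q powi (-n)" "d * Q powi n"] by simp
  qed
  moreover have "inverse x - x \<ge> (1 - norm Q) * inverse x"
  proof -
    have "x * x \<le> norm Q" using x Q by (smt (verit) mult_left_le)
    thus ?thesis using x by (simp add: field_simps)
  qed
  ultimately have le: "(1 - norm Q) * inverse x \<le> norm (den d Q n)" by simp
  moreover have "(1 - norm Q) * inverse x > 0" using x Q by simp
  ultimately have "1 / norm (den d Q n) \<le> 1 / ((1 - norm Q) * inverse x)"
    by (intro frac_le) auto
  thus ?thesis using x by (simp add: norm_divide field_simps x_def)
qed

text \<open>The two powers of \<open>Q\<close> have inverse norms, so a zero would force both norms
  to be 1, which is impossible for \<open>n \<noteq> 0\<close>.\<close>

lemma den_nonzero: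
  assumes Q: "Q \<noteq> 0" "norm Q < 1" and d: "d \<in> {1, -1}" and "n \<noteq> 0 \<or> d = -1"
  shows "den d Q n \<noteq> 0"
proof (cases "n = 0")
  case True
  thus ?thesis using assms by (auto simp: den_def)
next
  case False
  show ?thesis
  proof
    assume "den d Q n = 0"
    hence "norm (Q powi (- n)) = norm (d * Q powi n)" by (simp add: den_def)
    hence "norm (Q powi (- n)) = norm (Q powi n)" using d by (auto simp: norm_mult)
    moreover have "norm (Q powi (- n)) * norm (Q powi n) = 1"
      using Q by (simp flip: norm_mult power_int_add)
    ultimately show False
      using norm_powi_lt_1[OF Q, of n] norm_powi_lt_1[OF Q, of "- n"] False
      by (metis abs_norm_cancel abs_mult_less linorder_neqE_linordered_idom mult_1 neg_0_less_iff_less order_less_irrefl)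
  qed
qed

lemma geo_bounded_div_den:
  assumes Q: "Q \<noteq> 0" "norm Q < 1" and d: "d \<in> {1, -1}" and b: "\<And>n. norm (b n) \<le> B"
  shows "geo_bounded (\<lambda>n. b n / den d Q n)"
proof -
  have "geo_bounded (\<lambda>n. 1 / den d Q n)"
    by (rule geo_boundedI[OF norm_ge_zero Q(2) norm_inverse_den_le[OF Q d]])
  from geo_bounded_bounded_mult[OF this b] show ?thesis by simp
qed

lemma den_uminus: "d \<in> {1, -1} \<Longrightarrow> den d Q (- n) = - d * den d Q n"
  by (auto simp: den_def)

text \<open>The quotient is a hyperbolic cotangent for \<open>d = 1\<close> and a hyperbolic tangent
  for \<open>d = -1\<close>. It tends to 1 and -1 at the two ends; removing these limits leaves an
  odd summable sequence.\<close>

definition coth_rem :: "complex \<Rightarrow> complex \<Rightarrow> int \<Rightarrow> complex" where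
  "coth_rem d Q n = (Q powi (- n) + d * Q powi n) / den d Q n - of_int (sgn n)"

lemma coth_rem_uminus: "d \<in> {1, -1} \<Longrightarrow> coth_rem d Q (- n) = - coth_rem d Q n"
  by (auto simp: coth_rem_def den_def field_simps divide_simps) 

lemma geo_bounded_coth_rem:
  assumes Q: "Q \<noteq> 0" "norm Q < 1" and d: "d \<in> {1, -1}"
  shows "geo_bounded (coth_rem d Q)"
proof -
  \<comment> \<open>This is the numerator that remains after the sign is put over the common
    denominator.\<close>
  define b where "b = (\<lambda>n. if n = 0 then 0 else if n > 0 then 2 * d * Q powi n else 2 * Q powi (- n))"
  have "norm (b n) \<le> 2" for n
    using norm_powi_lt_1[OF Q, of n] norm_powi_lt_1[OF Q, of "-n"] d
    by (auto simp: b_def norm_mult)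
  from geo_bounded_div_den[OF Q d this] have "geo_bounded (\<lambda>n. b n / den d Q n)" .
  moreover have "b n / den d Q n = coth_rem d Q n" for n
  proof (cases "n = 0")
    case True
    thus ?thesis using d by (auto simp: b_def coth_rem_def den_def)
  next
    case False
    have "den d Q n \<noteq> 0" using den_nonzero[OF Q d] False by simp
    thus ?thesis using False
      by (auto simp: b_def coth_rem_def sgn_if field_simps) (auto simp: den_def algebra_simps)
  qed
  ultimately show ?thesis by simp
qed

text \<open>The addition theorem of the hyperbolic cotangent linearises the summand; only the
  sign parts of the two cotangents survive the summation over \<open>s\<close>.\<close>

lemma inverse_den_mult:
  assumes Q: "Q \<noteq> 0" "norm Q < 1" and d: "d \<in> {1, -1}"
    and "s \<noteq> 0 \<or> d = -1" "t \<noteq> 0 \<or> d = -1" "s + t \<noteq> 0"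
  shows "1 / (den d Q s * den d Q t) =
    (of_int (sgn s) + of_int (sgn t) + coth_rem d Q s + coth_rem d Q t) / (2 * den 1 Q (s + t))"
proof -
  have nz: "den d Q s \<noteq> 0" "den d Q t \<noteq> 0" "den 1 Q (s + t) \<noteq> 0"
    using assms den_nonzero[OF Q d] den_nonzero[OF Q, of 1] by auto
  have pp: "Q powi (s + t) = Q powi s * Q powi t" "Q powi (- s - t) = Q powi (- s) * Q powi (- t)"
    using Q by (auto simp flip: power_int_add)
  have "(Q powi (- s) + d * Q powi s) * den d Q t + (Q powi (- t) + d * Q powi t) * den d Q s =
        2 * den 1 Q (s + t)"
    using d by (auto simp: den_def pp algebra_simps)
  hence "(Q powi (- s) + d * Q powi s) / den d Q s + (Q powi (- t) + d * Q powi t) / den d Q t =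
        2 * den 1 Q (s + t) / (den d Q s * den d Q t)"
    using nz by (simp add: add_frac_eq mult_ac)
  thus ?thesis using nz by (simp add: coth_rem_def field_simps)
qed

lemma infsum_odd_int_0:
  fixes f :: "int \<Rightarrow> complex"
  assumes "\<And>n. f (- n) = - f n"
  shows "infsum f UNIV = 0"
proof -
  have "bij_betw uminus (UNIV :: int set) UNIV"
    by (rule bij_betwI[of _ _ _ uminus]) auto
  hence "infsum f UNIV = (\<Sum>\<^sub>\<infinity>n. f (- n))" by (rule infsum_reindex_bij_betw [symmetric])
  also have "\<dots> = - infsum f UNIV" by (simp add: assms infsum_uminus)
  finally show ?thesis by simp
qed

lemma bij_int_diff: "bij_betw (\<lambda>s. r - s) (UNIV :: int set) UNIV"
  by (rule bij_betwI[of _ _ _ "\<lambda>s. r - s"]) auto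

text \<open>Both remainder series vanish: one is odd in \<open>s\<close>, the other becomes a
  multiple of it under \<open>s \<mapsto> r - s\<close>, thanks to the symmetry of
  \<open>\<omega>\<close> with multiplier \<open>\<kappa>\<close>. The condition at 0 removes the
  zeros of the denominators at \<open>s = 0\<close> and \<open>s = r\<close> for
  \<open>d = 1\<close>. The weights used later are 1, the alternating sign and the indicator of odd
  numbers.\<close>

lemma infsum_inverse_den_mult:
  assumes Q: "Q \<noteq> 0" "norm Q < 1" and d: "d \<in> {1, -1}" and r: "r > 0"
    and \<omega>: "\<And>s. norm (\<omega> s) \<le> 1" "\<And>s. \<omega> (- s) = \<omega> s" "\<And>s. \<omega> (r - s) = \<kappa> * \<omega> s"
    and \<omega>0: "d = 1 \<Longrightarrow> \<omega> 0 = 0"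
  shows "(\<Sum>\<^sub>\<infinity>s. \<omega> s / (den d Q s * den d Q (r - s))) =
    (\<omega> 0 + \<omega> r + 2 * (\<Sum>s\<in>{1..r - 1}. \<omega> s)) / (2 * den 1 Q r)"
proof -
  define A where "A = (\<lambda>s. \<omega> s * (of_int (sgn s) + of_int (sgn (r - s))))"
  define B where "B = (\<lambda>s. \<omega> s * coth_rem d Q s)"
  define C where "C = (\<lambda>s. \<omega> s * coth_rem d Q (r - s))"
  have \<omega>r: "\<omega> r = \<kappa> * \<omega> 0" using \<omega>(3)[of 0] by simp
  have eq: "\<omega> s / (den d Q s * den d Q (r - s)) = (A s + B s + C s) / (2 * den 1 Q r)" for s
  proof (cases "\<omega> s = 0")
    case False
    hence "s \<noteq> 0 \<or> d = -1" "r - s \<noteq> 0 \<or> d = -1"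
      using \<omega>0 \<omega>r d by auto
    from inverse_den_mult[OF Q d this] r
    have "\<omega> s * (1 / (den d Q s * den d Q (r - s))) = \<omega> s * ((of_int (sgn s) + of_int (sgn (r - s)) +
       coth_rem d Q s + coth_rem d Q (r - s)) / (2 * den 1 Q r))" by simp
    thus ?thesis by (simp add: A_def B_def C_def algebra_simps)
  qed (simp add: A_def B_def C_def)
  \<comment> \<open>The sum of the two signs is 2 strictly between 0 and \<open>r\<close>, 1 at
    either end and 0 outside.\<close>
  have hA: "(A has_sum (\<omega> 0 + \<omega> r + 2 * (\<Sum>s\<in>{1..r - 1}. \<omega> s))) UNIV"
  proof (rule has_sum_finite_neutralI[of "insert 0 (insert r {1..r - 1})"])
    show "\<And>x. x \<in> UNIV - insert 0 (insert r {1..r - 1}) \<Longrightarrow> A x = 0"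
      using r by (auto simp: A_def sgn_if)
    have "(\<Sum>s\<in>{1..r - 1}. A s) = (\<Sum>s\<in>{1..r - 1}. 2 * \<omega> s)"
      by (intro sum.cong) (auto simp: A_def)
    thus "\<omega> 0 + \<omega> r + 2 * (\<Sum>s\<in>{1..r - 1}. \<omega> s) = sum A (insert 0 (insert r {1..r - 1}))"
      using r by (simp add: A_def sum_distrib_left)
  qed auto
  have gB: "B summable_on UNIV"
    unfolding B_def by (intro geo_bounded_summable geo_bounded_bounded_mult[OF geo_bounded_coth_rem[OF Q d]]) (rule \<omega>)
  have B0: "infsum B UNIV = 0"
    by (rule infsum_odd_int_0) (simp add: B_def \<omega> coth_rem_uminus[OF d])
  have CB: "C (r - s) = \<kappa> * B s" for s by (simp add: B_def C_def \<omega>)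
  have gC: "C summable_on UNIV"
    using summable_on_cmult_right[OF gB, of \<kappa>]
    by (subst summable_on_reindex_bij_betw[OF bij_int_diff[of r], symmetric]) (simp add: CB)
  have C0: "infsum C UNIV = 0"
    by (subst infsum_reindex_bij_betw[OF bij_int_diff[of r], symmetric]) (simp add: CB infsum_cmult_right' B0)
  have "((\<lambda>s. A s + B s + C s) has_sum (\<omega> 0 + \<omega> r + 2 * (\<Sum>s\<in>{1..r - 1}. \<omega> s) + 0 + 0)) UNIV"
    using gB gC B0 C0 hA by (intro has_sum_add) (auto simp: has_sum_iff)
  from has_sum_divide_const[OF this, of "2 * den 1 Q r"] show ?thesis
    unfolding eq by (intro infsumI) simp
qed

section \<open>Fourier coefficients of dn and sn and their convolutions\<close>

definition alt :: "int \<Rightarrow> complex" where "alt n = (if even n then 1 else - 1)"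

definition dn_coeff :: "complex \<Rightarrow> int \<Rightarrow> complex" where
  "dn_coeff Q n = 1 / den (- 1) Q n"

definition sn_coeff :: "complex \<Rightarrow> int \<Rightarrow> complex" where
  "sn_coeff Q n = (if odd n then 1 / den 1 Q n else 0)"

text \<open>With \<open>e = 1\<close> for even and \<open>e = -1\<close> for odd sequences, this
  lets the convolution formulas be proved for positive \<open>r\<close> and then reflected.\<close>

lemma conv_uminus:
  assumes "\<And>n. f (- n) = e * f n" "\<And>n. g (- n) = e * g n" "e * e = 1"
  shows "conv f g (- r) = conv f g r"
proof -
  have b: "bij_betw uminus (UNIV :: int set) UNIV"
    by (rule bij_betwI[of _ _ _ uminus]) auto
  have "conv f g (- r) = (\<Sum>\<^sub>\<infinity>s. f (- s) * g (- r - (- s)))"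
    unfolding conv_def by (rule infsum_reindex_bij_betw[OF b, symmetric])
  also have "\<dots> = (\<Sum>\<^sub>\<infinity>s. (e * f s) * (e * g (r - s)))"
  proof -
    have "- r - (- s) = - (r - s)" for s by simp
    thus ?thesis by (simp only: assms)
  qed
  also have "\<dots> = conv f g r"
  proof -
    have "(e * a) * (e * b) = a * b" for a b
      using assms(3) by (metis (no_types, lifting) mult.assoc mult.left_commute mult_1)
    thus ?thesis by (simp only: conv_def)
  qed
  finally show ?thesis .
qed

lemma sum_alt_int: "n \<ge> 0 \<Longrightarrow> (\<Sum>s\<in>{1..n}. alt s) = (if even n then 0 else - 1)"
proof (induction n rule: int_ge_induct)
  case (step i)
  have "{1..i + 1} = insert (i + 1) {1..i}" using step by auto
  thus ?case using step by (auto simp: alt_def)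
qed simp

lemma sum_odd_int: "n \<ge> 0 \<Longrightarrow> (\<Sum>s\<in>{1..n}. if odd s then 1 else 0 :: complex) = of_int ((n + 1) div 2)"
proof (induction n rule: int_ge_induct)
  case (step i)
  have "{1..i + 1} = insert (i + 1) {1..i}" using step by auto
  thus ?case using step by (auto elim!: evenE oddE)
qed simp

lemma dn_coeff_uminus: "dn_coeff Q (- n) = dn_coeff Q n"
  by (simp add: dn_coeff_def den_uminus)

lemma sn_coeff_uminus: "sn_coeff Q (- n) = - sn_coeff Q n"
  by (simp add: sn_coeff_def den_uminus)

lemma alt_uminus: "alt (- n) = alt n" by (simp add: alt_def)

context
  fixes Q :: complex
  assumes Q: "Q \<noteq> 0" "norm Q < 1"
begin

lemma conv_dn_dn:
  assumes "r \<noteq> 0"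
  shows "conv (dn_coeff Q) (dn_coeff Q) r = of_int r / den 1 Q r"
proof -
  have pos: "conv (dn_coeff Q) (dn_coeff Q) r = of_int r / den 1 Q r" if "r > 0" for r
  proof -
    have "conv (dn_coeff Q) (dn_coeff Q) r = (\<Sum>\<^sub>\<infinity>s. 1 / (den (- 1) Q s * den (- 1) Q (r - s)))"
      by (simp add: conv_def dn_coeff_def)
    also have "\<dots> = (1 + 1 + 2 * (\<Sum>s\<in>{1..r - 1}. 1)) / (2 * den 1 Q r)"
      by (rule infsum_inverse_den_mult[OF Q, where \<kappa> = 1]) (use that in auto)
    finally show ?thesis using that by (simp add: algebra_simps)
  qed
  show ?thesis
  proof (cases "r > 0")
    case False
    thus ?thesis using pos[of "- r"] assms conv_uminus[of "dn_coeff Q" 1 "dn_coeff Q" r]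
      by (simp add: dn_coeff_uminus den_uminus)
  qed (rule pos)
qed

text \<open>The end terms cancel twice the alternating sum between them. The alternating sign
  translates the Fourier series by half its period, so this is the coefficient form of dn(u) dn(u +
  K) being constant.\<close>

lemma conv_dn_alt_dn:
  assumes "r \<noteq> 0"
  shows "conv (\<lambda>n. alt n * dn_coeff Q n) (dn_coeff Q) r = 0"
proof -
  have pos: "conv (\<lambda>n. alt n * dn_coeff Q n) (dn_coeff Q) r = 0" if "r > 0" for r
  proof -
    have "conv (\<lambda>n. alt n * dn_coeff Q n) (dn_coeff Q) r =
        (\<Sum>\<^sub>\<infinity>s. alt s / (den (- 1) Q s * den (- 1) Q (r - s)))"
      by (simp add: conv_def dn_coeff_def)
    also have "\<dots> = (alt 0 + alt r + 2 * (\<Sum>s\<in>{1..r - 1}. alt s)) / (2 * den 1 Q r)"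
      by (rule infsum_inverse_den_mult[OF Q, where \<kappa> = "alt r"]) (use that in \<open>auto simp: alt_def\<close>)
    also have "\<dots> = 0" using that by (simp add: sum_alt_int) (simp add: alt_def)
    finally show ?thesis .
  qed
  show ?thesis
  proof (cases "r > 0")
    case False
    thus ?thesis using pos[of "- r"] assms conv_uminus[of "\<lambda>n. alt n * dn_coeff Q n" 1 "dn_coeff Q" r]
      by (simp add: dn_coeff_uminus alt_uminus)
  qed (rule pos)
qed

text \<open>Two odd frequencies only add up to even ones; for even \<open>r\<close> there are
  \<open>r div 2\<close> odd numbers between 0 and \<open>r\<close>, whence the factor 1/2 compared
  with the convolution for dn.\<close>

lemma conv_sn_sn:
  assumes "r \<noteq> 0"
  shows "conv (sn_coeff Q) (sn_coeff Q) r = (if even r then of_int r / (2 * den 1 Q r) else 0)"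
proof -
  have pos: "conv (sn_coeff Q) (sn_coeff Q) r = (if even r then of_int r / (2 * den 1 Q r) else 0)"
    if "r > 0" for r
  proof (cases "even r")
    case False
    hence "sn_coeff Q s * sn_coeff Q (r - s) = 0" for s by (auto simp: sn_coeff_def)
    thus ?thesis using False by (simp only: conv_def infsum_0_simp if_False)
  next
    case True
    have "sn_coeff Q s * sn_coeff Q (r - s) =
        (if odd s then 1 else 0) / (den 1 Q s * den 1 Q (r - s))" for s
      using True by (auto simp: sn_coeff_def)
    hence "conv (sn_coeff Q) (sn_coeff Q) r =
        (\<Sum>\<^sub>\<infinity>s. (if odd s then 1 else 0) / (den 1 Q s * den 1 Q (r - s)))"
      by (simp add: conv_def)
    also have "\<dots> = ((if odd (0::int) then 1 else 0) + (if odd r then 1 else 0) +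
        2 * (\<Sum>s\<in>{1..r - 1}. if odd s then 1 else 0)) / (2 * den 1 Q r)"
      by (rule infsum_inverse_den_mult[OF Q, where \<kappa> = 1]) (use that True in auto)
    also have "\<dots> = of_int (2 * (r div 2)) / (2 * den 1 Q r)"
      using that True by (subst sum_odd_int) auto
    also have "2 * (r div 2) = r" using True by simp
    finally show ?thesis using True by simp
  qed
  show ?thesis
  proof (cases "r > 0")
    case False
    thus ?thesis using pos[of "- r"] assms conv_uminus[of "sn_coeff Q" "- 1" "sn_coeff Q" r]
      by (simp add: sn_coeff_uminus den_uminus)
  qed (rule pos)
qed

end

section \<open>The differential equation\<close>

lemma fourier_fps_nth:
  "fps_nth (fourier_fps f) k = (\<Sum>\<^sub>\<infinity>n. fps_nth (fps_exp (of_int n / 2)) k * f n)"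
  by (simp only: fourier_fps_def fps_nth_Abs_fps)

text \<open>The extra term at \<open>n = 0\<close> is there because the convolution formulas leave
  the coefficient of frequency 0 undetermined.\<close>

lemma fourier_fps_combination:
  assumes "geo_bounded f" "geo_bounded g"
  shows "fourier_fps (\<lambda>n. a * f n + b * g n + (if n = 0 then c else 0)) =
    fps_const a * fourier_fps f + fps_const b * fourier_fps g + fps_const c"
proof (rule fps_ext)
  fix k
  define e where "e = (\<lambda>n. fps_nth (fps_exp (of_int n / 2 :: complex)) k)"
  have en: "fps_nth (fps_exp (of_int n / 2)) k = e n" for n :: int
    by (simp only: e_def)
  have f: "((\<lambda>n. a * (e n * f n)) has_sum a * fps_nth (fourier_fps f) k) UNIV"
    unfolding fourier_fps_nth e_def
    by (intro has_sum_cmult_right has_sum_infsum geo_bounded_summable geo_bounded_fps_exp_mult assms)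
  have g: "((\<lambda>n. b * (e n * g n)) has_sum b * fps_nth (fourier_fps g) k) UNIV"
    unfolding fourier_fps_nth e_def
    by (intro has_sum_cmult_right has_sum_infsum geo_bounded_summable geo_bounded_fps_exp_mult assms)
  have c: "((\<lambda>n. e n * (if n = 0 then c else 0)) has_sum fps_nth (fps_const c) k) UNIV"
    by (rule has_sum_finite_neutralI[of "{0}"]) (auto simp: e_def)
  from has_sum_add[OF has_sum_add[OF f g] c]
  show "fps_nth (fourier_fps (\<lambda>n. a * f n + b * g n + (if n = 0 then c else 0))) k =
    fps_nth (fps_const a * fourier_fps f + fps_const b * fourier_fps g + fps_const c) k"
    unfolding fourier_fps_nth[of "\<lambda>n. a * f n + b * g n + (if n = 0 then c else 0)"]
      en by (intro infsumI) (simp add: algebra_simps)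
qed

lemma fps_deriv_fourier_fps: "fps_deriv (fourier_fps f) = fourier_fps (\<lambda>n. of_int n / 2 * f n)"
proof (rule fps_ext)
  fix k
  have eq: "of_nat (k + 1) * (fps_nth (fps_exp (of_int n / 2)) (k + 1) * f n) =
      fps_nth (fps_exp (of_int n / 2)) k * (of_int n / 2 * f n)" for n :: int
  proof -
    have "of_nat (k + 1) * fps_nth (fps_exp (of_int n / 2)) (k + 1) =
        of_int n / 2 * fps_nth (fps_exp (of_int n / 2 :: complex)) k"
      by (simp only: fps_deriv_nth [symmetric] fps_exp_deriv fps_mult_left_const_nth)
    thus ?thesis by (simp only: mult.assoc [symmetric]) (simp only: mult_ac)
  qed
  have "fps_nth (fps_deriv (fourier_fps f)) k =
      (\<Sum>\<^sub>\<infinity>n. of_nat (k + 1) * (fps_nth (fps_exp (of_int n / 2)) (k + 1) * f n))"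
    by (simp only: fps_deriv_nth fourier_fps_nth infsum_cmult_right')
  also have "\<dots> = fps_nth (fourier_fps (\<lambda>n. of_int n / 2 * f n)) k"
    by (simp only: eq fourier_fps_nth)
  finally show "fps_nth (fps_deriv (fourier_fps f)) k = fps_nth (fourier_fps (\<lambda>n. of_int n / 2 * f n)) k" .
qed

lemma fourier_fps_nth_0: "fps_nth (fourier_fps f) 0 = infsum f UNIV"
  by (simp add: fourier_fps_nth)

text \<open>Apart from the constant term and scaling, these are the Fourier coefficients of the
  Weierstrass function translated by a half period, which differs from a multiple of the square of
  sn by a constant.\<close>

definition wp_coeff :: "complex \<Rightarrow> int \<Rightarrow> complex" where
  "wp_coeff Q n = (if even n then of_int n / (2 * den 1 Q n) else 0)"

context
  fixes Q :: complex
  assumes Q: "Q \<noteq> 0" "norm Q < 1"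
begin

lemma geo_bounded_dn: "geo_bounded (dn_coeff Q)"
  using geo_bounded_div_den[OF Q, of "-1" "\<lambda>_. 1" 1] by (simp add: dn_coeff_def[abs_def])

lemma geo_bounded_alt_mult: "geo_bounded f \<Longrightarrow> geo_bounded (\<lambda>n. alt n * f n)"
  by (erule geo_bounded_bounded_mult[where B = 1]) (auto simp: alt_def)

lemma geo_bounded_sn: "geo_bounded (sn_coeff Q)"
  using geo_bounded_div_den[OF Q, of 1 "\<lambda>n. if odd n then 1 else 0" 1]
  by (simp add: sn_coeff_def[abs_def] if_distrib if_distribR cong: if_cong)

lemma geo_bounded_wp: "geo_bounded (wp_coeff Q)"
proof -
  have "geo_bounded (\<lambda>n. of_int n * ((if even n then 1 / 2 else 0) / den 1 Q n))"
    by (intro geo_bounded_int_mult geo_bounded_div_den[OF Q, of 1 _ 1]) auto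
  moreover have "(\<lambda>n. of_int n * ((if even n then 1 / 2 else 0) / den 1 Q n)) = wp_coeff Q"
    by (auto simp: wp_coeff_def)
  ultimately show ?thesis by simp
qed

lemma sn_squared_ode:
  obtains \<phi> :: "complex fps" and a c where
    "fps_nth \<phi> 0 = 0" "fps_nth (fps_deriv \<phi>) 0 = 0"
    "fps_deriv \<phi> ^ 2 = 4 * \<phi> ^ 3 + fps_const a * \<phi> ^ 2 + 4 * fps_const c * \<phi>"
    "fps_deriv (fps_deriv \<phi>) = 6 * \<phi> ^ 2 + fps_const a * \<phi> + 2 * fps_const c"
    "\<And>n. n > 0 \<Longrightarrow> fps_nth \<phi> n = fps_nth (fourier_fps (wp_coeff Q)) n"
    "c = ((infsum (dn_coeff Q) UNIV ^ 2 - (\<Sum>\<^sub>\<infinity>n. alt n * dn_coeff Q n) ^ 2) / 4) ^ 2"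
proof -
  define F where "F = fourier_fps (dn_coeff Q)"
  define M where "M = fourier_fps (\<lambda>n. alt n * dn_coeff Q n)"
  define Y where "Y = fourier_fps (sn_coeff Q)"
  define E where "E = fourier_fps (wp_coeff Q)"
  define D where "D = fourier_fps (\<lambda>n. of_int n / 2 * sn_coeff Q n)"
  \<comment> \<open>A formal half with \<open>2 * h = 1\<close> keeps the following identities
    polynomial, so that Groebner bases can prove them in the ring of power series.\<close>
  define h :: "complex fps" where "h = fps_const (1/2)"
  have h: "2 * h = 1" by (simp add: h_def numeral_fps_const)
  \<comment> \<open>The three convolutions at frequency 0 stay unevaluated; they enter the result
    only through \<open>kV\<close> and \<open>kW\<close>.\<close>
  define c1 where "c1 = conv (dn_coeff Q) (dn_coeff Q) 0"
  define k where "k = conv (\<lambda>n. alt n * dn_coeff Q n) (dn_coeff Q) 0"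
  define c4 where "c4 = conv (sn_coeff Q) (sn_coeff Q) 0"
  have gD: "geo_bounded (\<lambda>n. of_int n / 2 * sn_coeff Q n)"
    using geo_bounded_bounded_mult[OF geo_bounded_int_mult[OF geo_bounded_sn], of "\<lambda>_. 1 / 2" "1 / 2"]
    by simp
  have F2: "F * F = 2 * E + 2 * D + fps_const c1"
  proof -
    have "F * F = fourier_fps (conv (dn_coeff Q) (dn_coeff Q))"
      unfolding F_def by (rule fourier_fps_mult) (rule geo_bounded_dn)+
    also have "conv (dn_coeff Q) (dn_coeff Q) = (\<lambda>n. (2 * wp_coeff Q n + 2 * (of_int n / 2 * sn_coeff Q n)) +
        (if n = 0 then c1 else 0))"
    proof
      fix n
      show "conv (dn_coeff Q) (dn_coeff Q) n = (2 * wp_coeff Q n + 2 * (of_int n / 2 * sn_coeff Q n)) +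
        (if n = 0 then c1 else 0)"
        by (cases "n = 0") (auto simp: conv_dn_dn[OF Q] wp_coeff_def sn_coeff_def c1_def)
    qed
    also have "fourier_fps \<dots> = 2 * E + 2 * D + fps_const c1"
      unfolding E_def D_def
      by (subst fourier_fps_combination[OF geo_bounded_wp gD]) (simp only: numeral_fps_const)
    finally show ?thesis .
  qed
  have M2: "M * M = 2 * E - 2 * D + fps_const c1"
  proof -
    have "M * M = fourier_fps (conv (\<lambda>n. alt n * dn_coeff Q n) (\<lambda>n. alt n * dn_coeff Q n))"
      unfolding M_def by (rule fourier_fps_mult) (rule geo_bounded_alt_mult geo_bounded_dn)+
    also have "conv (\<lambda>n. alt n * dn_coeff Q n) (\<lambda>n. alt n * dn_coeff Q n) =
        (\<lambda>n. alt n * conv (dn_coeff Q) (dn_coeff Q) n)"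
    proof
      fix n
      have "alt s * dn_coeff Q s * (alt (n - s) * dn_coeff Q (n - s)) =
         alt n * (dn_coeff Q s * dn_coeff Q (n - s))" for s
        by (auto simp: alt_def)
      thus "conv (\<lambda>n. alt n * dn_coeff Q n) (\<lambda>n. alt n * dn_coeff Q n) n =
         alt n * conv (dn_coeff Q) (dn_coeff Q) n"
        by (simp only: conv_def infsum_cmult_right')
    qed
    also have "\<dots> = (\<lambda>n. (2 * wp_coeff Q n + (- 2) * (of_int n / 2 * sn_coeff Q n)) +
        (if n = 0 then c1 else 0))"
    proof
      fix n
      show "alt n * conv (dn_coeff Q) (dn_coeff Q) n =
         (2 * wp_coeff Q n + (- 2) * (of_int n / 2 * sn_coeff Q n)) + (if n = 0 then c1 else 0)"
        by (cases "n = 0") (auto simp: conv_dn_dn[OF Q] wp_coeff_def sn_coeff_def c1_def alt_def)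
    qed
    also have "fourier_fps \<dots> = 2 * E + fps_const (- 2) * D + fps_const c1"
      unfolding E_def D_def
      by (subst fourier_fps_combination[OF geo_bounded_wp gD]) (simp only: numeral_fps_const)
    also have "fps_const (- 2) = (- 2 :: complex fps)"
      by (simp add: numeral_fps_const)
    finally show ?thesis by simp
  qed
  have MF: "M * F = fps_const k"
  proof -
    have "M * F = fourier_fps (conv (\<lambda>n. alt n * dn_coeff Q n) (dn_coeff Q))"
      unfolding M_def F_def by (rule fourier_fps_mult) (rule geo_bounded_alt_mult geo_bounded_dn)+
    also have "conv (\<lambda>n. alt n * dn_coeff Q n) (dn_coeff Q) = (\<lambda>n. 0 * dn_coeff Q n + 0 * dn_coeff Q n + (if n = 0 then k else 0))"
      by (auto simp: k_def conv_dn_alt_dn[OF Q])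
    finally show ?thesis by (simp only: fourier_fps_combination[OF geo_bounded_dn geo_bounded_dn]) simp
  qed
  have Y2: "Y * Y = E + fps_const c4"
  proof -
    have "Y * Y = fourier_fps (conv (sn_coeff Q) (sn_coeff Q))"
      unfolding Y_def by (rule fourier_fps_mult) (rule geo_bounded_sn)+
    also have "conv (sn_coeff Q) (sn_coeff Q) = (\<lambda>n. 1 * wp_coeff Q n + 0 * wp_coeff Q n + (if n = 0 then c4 else 0))"
    proof
      fix n
      show "conv (sn_coeff Q) (sn_coeff Q) n = 1 * wp_coeff Q n + 0 * wp_coeff Q n + (if n = 0 then c4 else 0)"
        by (cases "n = 0") (auto simp: conv_sn_sn[OF Q] wp_coeff_def c4_def)
    qed
    also have "fourier_fps \<dots> = E + fps_const c4"
      unfolding E_def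
      by (simp only: fourier_fps_combination[OF geo_bounded_wp geo_bounded_wp]) simp
    finally show ?thesis .
  qed
  have Y': "fps_deriv Y = D" by (simp only: Y_def D_def fps_deriv_fourier_fps)
  have Y0: "fps_nth Y 0 = 0"
    unfolding Y_def fourier_fps_nth_0
    by (rule infsum_odd_int_0) (simp add: sn_coeff_uminus)
  \<comment> \<open>The alternating sign in \<open>M\<close> makes \<open>V\<close> and
    \<open>W\<close> the even- and odd-frequency parts of \<open>F\<close>, that is dn and cn;
    \<open>V * W = D\<close> is the derivative rule for sn.\<close>
  define V where "V = h * (F + M)"
  define W where "W = h * (F - M)"
  define kV where "kV = c1 / 2 + k / 2 - c4"
  define kW where "kW = c1 / 2 - k / 2 - c4"
  have kV: "fps_const kV = h * fps_const c1 + h * fps_const k - fps_const c4"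
    by (simp add: kV_def h_def)
  have kW: "fps_const kW = h * fps_const c1 - h * fps_const k - fps_const c4"
    by (simp add: kW_def h_def)
  have VW: "V * W = D" using F2 M2 h unfolding V_def W_def by Groebner_Basis.algebra
  have V2: "V * V = Y * Y + fps_const kV" using F2 M2 MF Y2 h unfolding V_def kV by Groebner_Basis.algebra
  have W2: "W * W = Y * Y + fps_const kW" using F2 M2 MF Y2 h unfolding W_def kW by Groebner_Basis.algebra
  \<comment> \<open>Evaluation at 0, where \<open>Y\<close> vanishes, determines the constants
    without computing \<open>c1\<close>, \<open>k\<close> or \<open>c4\<close>.\<close>
  have kV0: "kV = fps_nth V 0 ^ 2"
    using arg_cong[OF V2, of "\<lambda>f. fps_nth f 0"] Y0 by (simp add: power2_eq_square)
  have kW0: "kW = fps_nth W 0 ^ 2"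
    using arg_cong[OF W2, of "\<lambda>f. fps_nth f 0"] Y0 by (simp add: power2_eq_square)
  define \<phi> where "\<phi> = Y * Y"
  have \<phi>': "fps_deriv \<phi> = 2 * (Y * V * W)"
    using VW by (simp add: \<phi>_def Y' algebra_simps)
  have sq: "fps_deriv \<phi> ^ 2 = 4 * \<phi> ^ 3 + fps_const (4 * (kV + kW)) * \<phi> ^ 2 + 4 * fps_const (kV * kW) * \<phi>"
  proof -
    have "fps_deriv \<phi> ^ 2 = 4 * \<phi> * (\<phi> + fps_const kV) * (\<phi> + fps_const kW)"
      using V2 W2 unfolding \<phi>' unfolding \<phi>_def by Groebner_Basis.algebra
    also have "\<dots> = 4 * \<phi> ^ 3 + (4 * (fps_const kV + fps_const kW)) * \<phi> ^ 2 + 4 * (fps_const kV * fps_const kW) * \<phi>"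
      by Groebner_Basis.algebra
    also have "4 * (fps_const kV + fps_const kW) = fps_const (4 * (kV + kW))"
      by (simp add: numeral_fps_const)
    finally show ?thesis by simp
  qed
  let ?R = "6 * \<phi> ^ 2 + fps_const (4 * (kV + kW)) * \<phi> + 2 * fps_const (kV * kW)"
  have dd: "fps_deriv (fps_deriv \<phi>) = ?R"
  \<comment> \<open>The second-order equation comes from differentiating the first-order one and
    cancelling \<open>fps_deriv \<phi>\<close>. If that factor is 0, then \<open>\<phi>\<close> and
    \<open>Y\<close> vanish, hence so does \<open>V * W\<close>, and the right-hand side is
    0.\<close>
  proof (cases "fps_deriv \<phi> = 0")
    case True
    hence "\<phi> = fps_const (fps_nth \<phi> 0)" by (simp only: fps_deriv_eq_0_iff)
    moreover have "fps_nth \<phi> 0 = 0" using Y0 by (simp add: \<phi>_def)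
    ultimately have \<phi>0: "\<phi> = 0" by simp
    hence "Y = 0" by (simp add: \<phi>_def)
    hence "V * W = 0" using VW Y' by simp
    hence "V = 0 \<or> W = 0" by simp
    hence "kV * kW = 0" by (auto simp: kV0 kW0)
    thus ?thesis using True \<phi>0 by simp
  next
    case False
    have "fps_deriv (fps_deriv \<phi> ^ 2) = fps_deriv (4 * \<phi> ^ 3 + fps_const (4 * (kV + kW)) * \<phi> ^ 2 + 4 * fps_const (kV * kW) * \<phi>)"
      by (simp only: sq)
    moreover have n0: "fps_deriv (numeral x :: complex fps) = 0" for x
      by (simp add: numeral_fps_const)
    ultimately have "fps_deriv \<phi> * (2 * fps_deriv (fps_deriv \<phi>)) = fps_deriv \<phi> * (2 * ?R)"
      by (simp add: power2_eq_square power3_eq_cube algebra_simps)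
    hence "2 * fps_deriv (fps_deriv \<phi>) = 2 * ?R"
      by (rule mult_left_cancel[OF False, THEN iffD1])
    thus ?thesis using h by Groebner_Basis.algebra
  qed
  show ?thesis
  proof (rule that[OF _ _ sq dd])
    show "fps_nth \<phi> 0 = 0" using Y0 by (simp add: \<phi>_def)
    show "fps_nth (fps_deriv \<phi>) 0 = 0" using Y0 by (simp only: \<phi>' fps_mult_nth_0) simp
    show "fps_nth \<phi> n = fps_nth (fourier_fps (wp_coeff Q)) n" if "n > 0" for n
      using that by (simp add: \<phi>_def Y2 E_def)
    have "fps_nth V 0 * fps_nth W 0 = (fps_nth F 0 ^ 2 - fps_nth M 0 ^ 2) / 4"
      by (simp add: V_def W_def h_def field_simps power2_eq_square)
    thus "kV * kW = ((infsum (dn_coeff Q) UNIV ^ 2 - (\<Sum>\<^sub>\<infinity>n. alt n * dn_coeff Q n) ^ 2) / 4) ^ 2"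
      unfolding kV0 kW0 by (simp only: F_def M_def fourier_fps_nth_0 power_mult_distrib [symmetric])
  qed
qed

end

section \<open>Theta functions\<close>

definition theta :: "complex \<Rightarrow> complex" where
  "theta q = (\<Sum>\<^sub>\<infinity>n::int. q powi (n\<^sup>2))"

text \<open>This is the Jacobi function \<theta>_2 without its factor q^(1/4), which keeps all
  exponents integral; explicit factors \<open>q\<close> in the identities below compensate for
  it.\<close>

definition theta_tri :: "complex \<Rightarrow> complex" where
  "theta_tri q = (\<Sum>\<^sub>\<infinity>n::int. q powi (n * (n + 1)))"

lemma minus_powi: "(- q :: complex) powi n = alt n * q powi n"
  using power_int_mult_distrib[of "- 1" q n] by (auto simp: alt_def power_int_minus_left)

lemma norm_alt: "norm (alt n) = 1"
  by (simp add: alt_def)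

lemma abs_le_square_int: "\<bar>n\<bar> \<le> (n::int)\<^sup>2"
  using self_le_power[of "\<bar>n\<bar>" 2] by (cases "n = 0") auto

lemma abs_le_pronic_int: "\<bar>n\<bar> - 1 \<le> (n::int) * (n + 1)"
  using abs_le_square_int[of n] abs_le_square_int[of "n + 1"]
  by (auto simp: power2_eq_square algebra_simps)

context
  fixes q :: complex
  assumes q: "q \<noteq> 0" "norm q < 1"
begin

lemma geo_bounded_powi:
  assumes "\<And>n. \<bar>n\<bar> - 1 \<le> e n"
  shows "geo_bounded (\<lambda>n. q powi e n)"
proof (rule geo_boundedI[OF norm_ge_zero q(2)])
  fix n
  have "norm (q powi e n) = norm q powi (e n)" by (simp add: norm_power_int)
  also have "\<dots> \<le> norm q powi (\<bar>n\<bar> - 1)"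
    using assms q by (intro power_int_decreasing) auto
  also have "\<dots> = 1 / norm q * norm q ^ nat \<bar>n\<bar>"
    using q by (subst power_int_diff) (auto simp: power_int_def)
  finally show "norm (q powi e n) \<le> 1 / norm q * norm q ^ nat \<bar>n\<bar>" .
qed

lemma geo_bounded_theta: "geo_bounded (\<lambda>n. q powi (n\<^sup>2))"
  using abs_le_square_int by (intro geo_bounded_powi) (smt (verit))

lemma geo_bounded_theta_tri: "geo_bounded (\<lambda>n. q powi (n * (n + 1)))"
  by (rule geo_bounded_powi[OF abs_le_pronic_int])

text \<open>The reflection \<open>n \<mapsto> - 1 - n\<close> preserves \<open>n * (n + 1)\<close>
  and flips the parity of \<open>n\<close>.\<close>

lemma infsum_alt_tri: "(\<Sum>\<^sub>\<infinity>n. alt n * q powi (n * (n + 1))) = 0"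
proof -
  let ?f = "\<lambda>n. alt n * q powi (n * (n + 1))"
  have "infsum ?f UNIV = (\<Sum>\<^sub>\<infinity>n. ?f (- 1 - n))"
    by (rule infsum_reindex_bij_betw[OF bij_int_diff, symmetric])
  also have "?f (- 1 - n) = - ?f n" for n
  proof -
    have "(- 1 - n) * (- 1 - n + 1) = n * (n + 1)" by (simp add: algebra_simps)
    thus ?thesis by (simp only:) (simp add: alt_def)
  qed
  hence "(\<Sum>\<^sub>\<infinity>n. ?f (- 1 - n)) = - infsum ?f UNIV" by (simp only: infsum_uminus)
  finally show ?thesis by simp
qed

end

text \<open>Pairs with even coordinate sum are exactly the \<open>(i + j, i - j)\<close>, those with
  odd sum exactly the \<open>(i + j + 1, i - j)\<close>.\<close>

lemma infsum_int_pairs_by_parity: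
  fixes f :: "int \<times> int \<Rightarrow> complex"
  assumes "f summable_on UNIV"
  shows "infsum f UNIV = (\<Sum>\<^sub>\<infinity>(i, j). f (i + j, i - j)) + (\<Sum>\<^sub>\<infinity>(i, j). f (i + j + 1, i - j))"
proof -
  define g where "g = (\<lambda>(i, j). (i + j, i - j :: int))"
  define h where "h = (\<lambda>(i, j). (i + j + 1, i - j :: int))"
  have inj: "inj g" "inj h" by (auto simp: inj_def g_def h_def)
  have rg: "range g = {(a, b). even (a + b)}"
  proof (intro equalityI subsetI)
    fix x :: "int \<times> int" assume "x \<in> {(a, b). even (a + b)}"
    then obtain a b where x: "x = (a, b)" "even (a + b)" by auto
    hence "x = g ((a + b) div 2, (a - b) div 2)"
      by (auto simp: g_def elim!: evenE; presburger)
    thus "x \<in> range g" by blast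
  qed (auto simp: g_def)
  have rh: "range h = {(a, b). odd (a + b)}"
  proof (intro equalityI subsetI)
    fix x :: "int \<times> int" assume "x \<in> {(a, b). odd (a + b)}"
    then obtain a b where x: "x = (a, b)" "odd (a + b)" by auto
    hence "x = h ((a + b - 1) div 2, (a - b - 1) div 2)"
      by (auto simp: h_def elim!: oddE; presburger)
    thus "x \<in> range h" by blast
  qed (auto simp: h_def)
  have "UNIV = range g \<union> range h" "range g \<inter> range h = {}"
    unfolding rg rh by auto
  moreover have "f summable_on range g" "f summable_on range h"
    by (rule summable_on_subset_banach[OF assms]; simp)+
  ultimately have "infsum f UNIV = infsum f (range g) + infsum f (range h)"
    using infsum_Un_disjoint by metis
  also have "infsum f (range g) = (\<Sum>\<^sub>\<infinity>(i, j). f (i + j, i - j))"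
    by (subst infsum_reindex[OF inj(1)]) (simp add: g_def o_def case_prod_unfold)
  also have "infsum f (range h) = (\<Sum>\<^sub>\<infinity>(i, j). f (i + j + 1, i - j))"
    by (subst infsum_reindex[OF inj(2)]) (simp add: h_def o_def case_prod_unfold)
  finally show ?thesis .
qed

text \<open>In the coordinates \<open>i\<close> and \<open>j\<close> the sum of two quadratic
  exponents has no mixed term, so each parity class factors again. The constant \<open>c\<close>
  takes up the power of \<open>q\<close> left over in the odd class.\<close>

lemma infsum_times_by_parity:
  assumes fg: "geo_bounded f" "geo_bounded g" and f': "geo_bounded f1" "geo_bounded g1" "geo_bounded f2" "geo_bounded g2"
    and 1: "\<And>i j. f (i + j) * g (i - j) = f1 i * g1 j"
    and 2: "\<And>i j. f (i + j + 1) * g (i - j) = c * (f2 i * g2 j)"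
  shows "infsum f UNIV * infsum g UNIV = infsum f1 UNIV * infsum g1 UNIV + c * (infsum f2 UNIV * infsum g2 UNIV)"
proof -
  note ab = geo_bounded_abs_summable
  have s: "(\<lambda>(a, b). f a * g b) summable_on UNIV"
    using abs_summable_summable[OF abs_summable_times[OF ab[OF fg(1)] ab[OF fg(2)]]] by simp
  have "infsum f UNIV * infsum g UNIV = (\<Sum>\<^sub>\<infinity>(a, b). f a * g b)"
    using infsum_times[OF ab[OF fg(1)] ab[OF fg(2)]] by simp
  also have "\<dots> = (\<Sum>\<^sub>\<infinity>(i, j). f1 i * g1 j) + (\<Sum>\<^sub>\<infinity>(i, j). c * (f2 i * g2 j))"
    using infsum_int_pairs_by_parity[OF s] by (simp add: 1 2)
  also have "(\<Sum>\<^sub>\<infinity>(i, j). c * (f2 i * g2 j)) = c * (\<Sum>\<^sub>\<infinity>(i, j). f2 i * g2 j)"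
    by (simp add: case_prod_unfold infsum_cmult_right')
  also have "(\<Sum>\<^sub>\<infinity>(i, j). f1 i * g1 j) = infsum f1 UNIV * infsum g1 UNIV"
    using infsum_times[OF ab[OF f'(1)] ab[OF f'(2)]] by simp
  also have "(\<Sum>\<^sub>\<infinity>(i, j). f2 i * g2 j) = infsum f2 UNIV * infsum g2 UNIV"
    using infsum_times[OF ab[OF f'(3)] ab[OF f'(4)]] by simp
  finally show ?thesis .
qed

lemma powi_mult_eq:
  fixes q :: complex
  assumes "q \<noteq> 0" "a + b = 1 + (c + d)"
  shows "q powi a * q powi b = q * (q powi c * q powi d)"
  using assms by (metis power_int_add power_int_1_right)

lemma square_powi: "(q\<^sup>2) powi n = (q :: complex) powi (2 * n)"
  by (simp add: power_int_mult)

context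
  fixes q :: complex
  assumes q: "q \<noteq> 0" "norm q < 1"
begin

lemma square_nome: "q\<^sup>2 \<noteq> 0" "norm (q\<^sup>2) < 1" "- (q\<^sup>2) \<noteq> 0" "norm (- (q\<^sup>2)) < 1"
  using q by (auto simp: norm_power power_less_one_iff)

lemma minus_nome: "- q \<noteq> 0" "norm (- q) < 1" using q by auto

lemma theta_square: "theta q ^ 2 = theta (q\<^sup>2) ^ 2 + q * theta_tri (q\<^sup>2) ^ 2"
  unfolding theta_def theta_tri_def power2_eq_square[of "infsum _ _"]
proof (rule infsum_times_by_parity)
  fix i j :: int
  show "q powi (i + j)\<^sup>2 * q powi (i - j)\<^sup>2 = q\<^sup>2 powi i\<^sup>2 * q\<^sup>2 powi j\<^sup>2"
    unfolding square_powi using q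
    by (simp add: power_int_add [symmetric] power2_eq_square algebra_simps)
  show "q powi (i + j + 1)\<^sup>2 * q powi (i - j)\<^sup>2 = q * (q\<^sup>2 powi (i * (i + 1)) * q\<^sup>2 powi (j * (j + 1)))"
  proof -
    have "(i + j + 1)\<^sup>2 + (i - j)\<^sup>2 = 1 + (2 * (i * (i + 1)) + 2 * (j * (j + 1)))"
      by (simp add: power2_eq_square algebra_simps)
    thus ?thesis unfolding square_powi by (rule powi_mult_eq[OF q(1)])
  qed
qed (intro geo_bounded_theta geo_bounded_theta_tri q square_nome)+

text \<open>The odd class carries the sign \<open>alt i * alt j\<close> and therefore factors into
  two alternating pronic series, which are 0.\<close>

lemma theta_mult_theta_minus: "theta q * theta (- q) = theta (- (q\<^sup>2)) ^ 2"
proof -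
  have "theta q * theta (- q) = theta (- (q\<^sup>2)) * theta (- (q\<^sup>2)) +
     q * ((\<Sum>\<^sub>\<infinity>n. alt n * q\<^sup>2 powi (n * (n + 1))) * (\<Sum>\<^sub>\<infinity>n. alt n * q\<^sup>2 powi (n * (n + 1))))"
    unfolding theta_def
  proof (rule infsum_times_by_parity)
    fix i j :: int
    have a: "alt ((i - j)\<^sup>2) = alt (i\<^sup>2) * alt (j\<^sup>2)" "alt ((i - j)\<^sup>2) = alt i * alt j"
      by (auto simp: alt_def)
    show "q powi (i + j)\<^sup>2 * (- q) powi (i - j)\<^sup>2 = (- (q\<^sup>2)) powi i\<^sup>2 * (- (q\<^sup>2)) powi j\<^sup>2"
    proof -
      have "(i + j)\<^sup>2 + (i - j)\<^sup>2 = 2 * i\<^sup>2 + 2 * j\<^sup>2"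
        by (simp add: power2_eq_square algebra_simps)
      hence "q powi ((i + j)\<^sup>2 + (i - j)\<^sup>2) = q powi (2 * i\<^sup>2 + 2 * j\<^sup>2)" by (simp only:)
      thus ?thesis unfolding minus_powi square_powi a(1) using q
        by (simp add: power_int_add)
    qed
    show "q powi (i + j + 1)\<^sup>2 * (- q) powi (i - j)\<^sup>2 =
       q * (alt i * q\<^sup>2 powi (i * (i + 1)) * (alt j * q\<^sup>2 powi (j * (j + 1))))"
    proof -
      have "(i + j + 1)\<^sup>2 + (i - j)\<^sup>2 = 1 + (2 * (i * (i + 1)) + 2 * (j * (j + 1)))"
        by (simp add: power2_eq_square algebra_simps)
      hence "q powi (i + j + 1)\<^sup>2 * q powi (i - j)\<^sup>2 = q * (q powi (2 * (i * (i + 1))) * q powi (2 * (j * (j + 1))))"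
        by (rule powi_mult_eq[OF q(1)])
      thus ?thesis unfolding minus_powi square_powi a(2) by (simp add: mult_ac)
    qed
  qed (intro geo_bounded_theta geo_bounded_theta_tri geo_bounded_bounded_mult[of _ alt 1] q square_nome minus_nome; simp add: norm_alt)+
  thus ?thesis using infsum_alt_tri[OF square_nome(1,2)] by (simp add: power2_eq_square)
qed

text \<open>Both parity classes give the same product: the square exponents of the second are those
  of the first shifted by one.\<close>

lemma theta_tri_square: "theta_tri q ^ 2 = 2 * theta (q\<^sup>2) * theta_tri (q\<^sup>2)"
proof -
  have "theta_tri q * theta_tri q = theta_tri (q\<^sup>2) * theta (q\<^sup>2) +
     1 * ((\<Sum>\<^sub>\<infinity>n. q\<^sup>2 powi ((n + 1)\<^sup>2)) * theta_tri (q\<^sup>2))"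
    unfolding theta_def theta_tri_def
  proof (rule infsum_times_by_parity)
    fix i j :: int
    show "q powi ((i + j) * (i + j + 1)) * q powi ((i - j) * (i - j + 1)) = q\<^sup>2 powi (i * (i + 1)) * q\<^sup>2 powi j\<^sup>2"
    proof -
      have "(i + j) * (i + j + 1) + (i - j) * (i - j + 1) = 2 * (i * (i + 1)) + 2 * j\<^sup>2"
        by (simp add: power2_eq_square algebra_simps)
      hence "q powi ((i + j) * (i + j + 1) + (i - j) * (i - j + 1)) = q powi (2 * (i * (i + 1)) + 2 * j\<^sup>2)"
        by (simp only:)
      thus ?thesis unfolding square_powi using q by (simp add: power_int_add)
    qed
    show "q powi ((i + j + 1) * (i + j + 1 + 1)) * q powi ((i - j) * (i - j + 1)) =
       1 * (q\<^sup>2 powi ((i + 1)\<^sup>2) * q\<^sup>2 powi (j * (j + 1)))"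
    proof -
      have "(i + j + 1) * (i + j + 1 + 1) + (i - j) * (i - j + 1) = 2 * (i + 1)\<^sup>2 + 2 * (j * (j + 1))"
        by (simp add: power2_eq_square algebra_simps)
      hence "q powi ((i + j + 1) * (i + j + 1 + 1) + (i - j) * (i - j + 1)) = q powi (2 * (i + 1)\<^sup>2 + 2 * (j * (j + 1)))"
        by (simp only:)
      thus ?thesis unfolding square_powi using q by (simp add: power_int_add)
    qed
    have "\<bar>n\<bar> - 1 \<le> (n + 1)\<^sup>2" for n :: int using abs_le_square_int[of "n + 1"] by linarith
    thus "geo_bounded (\<lambda>n. q\<^sup>2 powi ((n + 1)\<^sup>2))"
      by (rule geo_bounded_powi[OF square_nome(1,2)])
  qed (intro geo_bounded_theta geo_bounded_theta_tri q square_nome)+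
  moreover have "(\<Sum>\<^sub>\<infinity>n. q\<^sup>2 powi ((n + 1)\<^sup>2)) = theta (q\<^sup>2)"
    unfolding theta_def by (rule infsum_reindex_bij_betw) (rule bij_betwI[of _ _ _ "\<lambda>n. n - 1"], auto)
  ultimately show ?thesis by (simp add: power2_eq_square)
qed

end

text \<open>Jacobi's quartic identity: the squares of \<open>theta q\<close> and
  \<open>theta (- q)\<close> are the sum and the difference of the same two terms, and the product
  of these terms is a multiple of \<open>(theta_tri q ^ 2) ^ 2\<close>.\<close>

lemma theta_fourth_power_diff:
  assumes q: "q \<noteq> 0" "norm q < 1"
  shows "theta q ^ 4 - theta (- q) ^ 4 = q * theta_tri q ^ 4"
proof -
  have 1: "theta q ^ 2 = theta (q\<^sup>2) ^ 2 + q * theta_tri (q\<^sup>2) ^ 2"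
    by (rule theta_square[OF q])
  have 2: "theta (- q) ^ 2 = theta (q\<^sup>2) ^ 2 - q * theta_tri (q\<^sup>2) ^ 2"
    using theta_square[of "- q"] q by simp
  show ?thesis using 1 2 theta_tri_square[OF q] by Groebner_Basis.algebra
qed

section \<open>Two squares\<close>

definition dn_sum :: "complex \<Rightarrow> complex" where
  "dn_sum q = infsum (dn_coeff q) UNIV"

lemma dn_coeff_minus: "dn_coeff (- q) n = alt n * dn_coeff q n"
proof -
  have "den (- 1) (- q) n = alt n * den (- 1) q n"
    by (simp add: den_def minus_powi alt_uminus algebra_simps)
  thus ?thesis by (simp add: dn_coeff_def alt_def)
qed

lemma dn_coeff_double: "dn_coeff q (2 * n) = dn_coeff (q\<^sup>2) n"
  by (simp add: dn_coeff_def den_def square_powi)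

context
  fixes q :: complex
  assumes q: "q \<noteq> 0" "norm q < 1"
begin

lemma geo_bounded_alt_theta: "geo_bounded (\<lambda>n. alt n * q powi (n\<^sup>2))"
  by (rule geo_bounded_bounded_mult[OF geo_bounded_theta[OF q], of _ 1]) (simp add: norm_alt)

text \<open>Multiplying \<open>1 / (q powi (- t) + q powi t)\<close> by
  \<open>q powi (- 2 * t)\<close> gives \<open>q powi (- t)\<close> minus the same fraction.
  Shifting \<open>s\<close> thus reproduces the convolution up to a factor, plus an alternating
  pronic series, which is 0.\<close>

lemma conv_theta_dn_step:
  "conv (\<lambda>n. alt n * q powi (n\<^sup>2)) (dn_coeff q) (k + 1) =
     q powi (2 * k + 1) * conv (\<lambda>n. alt n * q powi (n\<^sup>2)) (dn_coeff q) k"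
proof -
  let ?f = "\<lambda>n. alt n * q powi (n\<^sup>2)"
  have bij: "bij_betw (\<lambda>s. s + 1) (UNIV :: int set) UNIV"
    by (rule bij_betwI[of _ _ _ "\<lambda>n. n - 1"]) auto
  have "conv ?f (dn_coeff q) (k + 1) = (\<Sum>\<^sub>\<infinity>s. ?f (s + 1) * dn_coeff q (k + 1 - (s + 1)))"
    unfolding conv_def by (rule infsum_reindex_bij_betw[OF bij, symmetric])
  also have "\<dots> = (\<Sum>\<^sub>\<infinity>s. q powi (2 * k + 1) * (?f s * dn_coeff q (k - s)) +
       (- (q powi (k + 1))) * (alt s * q powi (s * (s + 1))))"
  proof (intro infsum_cong)
    fix s :: int
    define t where "t = k - s"
    have nz: "den (- 1) q t \<noteq> 0" using den_nonzero[OF q, of "- 1" t] by simp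
    have "q powi (- t) * den (- 1) q t = q powi (- 2 * t) + 1"
      using q by (simp add: den_def distrib_left power_int_add [symmetric])
    hence dn: "q powi (- 2 * t) * dn_coeff q t = q powi (- t) - dn_coeff q t"
      using nz by (simp add: dn_coeff_def field_simps)
    have "(s + 1)\<^sup>2 = s\<^sup>2 + (2 * k + 1) + (- 2 * t)"
      by (simp add: t_def power2_eq_square algebra_simps)
    hence 1: "q powi ((s + 1)\<^sup>2) = q powi (s\<^sup>2) * q powi (2 * k + 1) * q powi (- 2 * t)"
      by (simp only: power_int_add[OF disjI1[OF q(1)]])
    have 2: "q powi (s\<^sup>2) * q powi (2 * k + 1) * q powi (- t) = q powi (k + 1) * q powi (s * (s + 1))"
      using q by (simp add: t_def power_int_add [symmetric] power2_eq_square algebra_simps)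
    have "?f (s + 1) * dn_coeff q (k + 1 - (s + 1)) =
        - alt s * (q powi (s\<^sup>2) * q powi (2 * k + 1) * (q powi (- 2 * t) * dn_coeff q t))"
      unfolding 1 by (simp add: t_def) (simp add: alt_def)
    also have "\<dots> = q powi (2 * k + 1) * (?f s * dn_coeff q t) -
        alt s * (q powi (s\<^sup>2) * q powi (2 * k + 1) * q powi (- t))"
      unfolding dn by (simp add: algebra_simps)
    finally show "?f (s + 1) * dn_coeff q (k + 1 - (s + 1)) =
        q powi (2 * k + 1) * (?f s * dn_coeff q (k - s)) + (- (q powi (k + 1))) * (alt s * q powi (s * (s + 1)))"
      unfolding 2 by (simp add: t_def)
  qed
  also have "\<dots> = q powi (2 * k + 1) * conv ?f (dn_coeff q) k + (- (q powi (k + 1))) * (\<Sum>\<^sub>\<infinity>s. alt s * q powi (s * (s + 1)))"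
  proof -
    have "(\<lambda>s. ?f s * dn_coeff q (k - s)) summable_on UNIV"
    proof (rule geo_bounded_summable)
      have "geo_bounded (\<lambda>s. dn_coeff q (k - s) * ?f s)"
      proof (rule geo_bounded_bounded_mult[OF geo_bounded_alt_theta])
        fix s
        have "norm (dn_coeff q (k - s)) \<le> 1 / (1 - norm q) * norm q ^ nat \<bar>k - s\<bar>"
          unfolding dn_coeff_def by (rule norm_inverse_den_le[OF q]) simp
        also have "\<dots> \<le> 1 / (1 - norm q) * 1"
          using q by (intro mult_left_mono power_le_one) auto
        finally show "norm (dn_coeff q (k - s)) \<le> 1 / (1 - norm q)" by simp
      qed
      thus "geo_bounded (\<lambda>s. ?f s * dn_coeff q (k - s))" by (simp only: mult.commute)
    qed
    moreover have "(\<lambda>s. alt s * q powi (s * (s + 1))) summable_on UNIV"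
      by (intro geo_bounded_summable geo_bounded_bounded_mult[OF geo_bounded_theta_tri[OF q], of _ 1])
         (simp add: norm_alt)
    ultimately show ?thesis unfolding conv_def
      by (subst infsum_add; (intro summable_on_cmult_right)?) (simp_all only: infsum_cmult_right')
  qed
  finally show ?thesis by (simp add: infsum_alt_tri[OF q])
qed

text \<open>The factors \<open>q powi (2 * k + 1)\<close> multiply up to
  \<open>q powi (k\<^sup>2)\<close>. This is the coefficient form of the fact that a Laurent series
  with the quasi-periodicity of theta is a multiple of theta.\<close>

lemma conv_theta_dn:
  "conv (\<lambda>n. alt n * q powi (n\<^sup>2)) (dn_coeff q) k =
     conv (\<lambda>n. alt n * q powi (n\<^sup>2)) (dn_coeff q) 0 * q powi (k\<^sup>2)"
proof -
  have pos: "conv (\<lambda>n. alt n * q powi (n\<^sup>2)) (dn_coeff q) k =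
     conv (\<lambda>n. alt n * q powi (n\<^sup>2)) (dn_coeff q) 0 * q powi (k\<^sup>2)" if "k \<ge> 0" for k
    using that
  proof (induction k rule: int_ge_induct)
    case (step i)
    have "(i + 1)\<^sup>2 = (2 * i + 1) + i\<^sup>2" by (simp add: power2_eq_square algebra_simps)
    hence "q powi ((i + 1)\<^sup>2) = q powi (2 * i + 1) * q powi (i\<^sup>2)"
      by (simp only: power_int_add[OF disjI1[OF q(1)]])
    thus ?case unfolding conv_theta_dn_step step.IH by simp
  qed simp
  show ?thesis
  proof (cases "k \<ge> 0")
    case False
    thus ?thesis using pos[of "- k"]
      conv_uminus[of "\<lambda>n. alt n * q powi (n\<^sup>2)" 1 "dn_coeff q" k]
      by (simp add: alt_uminus dn_coeff_uminus)
  qed (rule pos)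
qed

text \<open>The character \<open>w\<close> commutes with convolution and evaluates the series at a
  point of the unit circle. The trivial character and the powers of \<i> give two equations
  containing the same unknown constant.\<close>

lemma theta_dn_twisted:
  assumes w: "\<And>m n. w (m + n) = w m * w n" "\<And>n. norm (w n) = 1"
  shows "(\<Sum>\<^sub>\<infinity>n. w n * (alt n * q powi (n\<^sup>2))) * (\<Sum>\<^sub>\<infinity>n. w n * dn_coeff q n) =
    conv (\<lambda>n. alt n * q powi (n\<^sup>2)) (dn_coeff q) 0 * (\<Sum>\<^sub>\<infinity>n. w n * q powi (n\<^sup>2))"
proof -
  let ?f = "\<lambda>n. alt n * q powi (n\<^sup>2)"
  have "geo_bounded (\<lambda>n. w n * ?f n)" "geo_bounded (\<lambda>n. w n * dn_coeff q n)"
    by (rule geo_bounded_bounded_mult[of _ _ 1]; simp add: w geo_bounded_alt_theta geo_bounded_dn[OF q])+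
  hence *: "(\<Sum>\<^sub>\<infinity>n. w n * ?f n) * (\<Sum>\<^sub>\<infinity>n. w n * dn_coeff q n) =
     infsum (conv (\<lambda>n. w n * ?f n) (\<lambda>n. w n * dn_coeff q n)) UNIV"
    by (rule infsum_conv)
  have cv: "conv (\<lambda>n. w n * ?f n) (\<lambda>n. w n * dn_coeff q n) k = w k * conv ?f (dn_coeff q) k" for k
  proof -
    have ww: "w s * w (k - s) = w k" for s using w(1)[of s "k - s"] by simp
    have "w s * ?f s * (w (k - s) * dn_coeff q (k - s)) = (w s * w (k - s)) * (?f s * dn_coeff q (k - s))" for s
      by (simp only: mult_ac)
    hence "w s * ?f s * (w (k - s) * dn_coeff q (k - s)) = w k * (?f s * dn_coeff q (k - s))" for s
      by (simp only: ww)
    thus ?thesis by (simp only: conv_def infsum_cmult_right')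
  qed
  have "infsum (conv (\<lambda>n. w n * ?f n) (\<lambda>n. w n * dn_coeff q n)) UNIV =
     (\<Sum>\<^sub>\<infinity>k. conv ?f (dn_coeff q) 0 * (w k * q powi (k\<^sup>2)))"
  proof (rule infsum_cong)
    fix k
    show "conv (\<lambda>n. w n * ?f n) (\<lambda>n. w n * dn_coeff q n) k = conv ?f (dn_coeff q) 0 * (w k * q powi (k\<^sup>2))"
      unfolding cv by (subst conv_theta_dn[of k]) (simp only: mult_ac)
  qed
  thus ?thesis by (simp only: * infsum_cmult_right')
qed

end

text \<open>For odd \<open>n\<close> the powers of \<i> with exponents \<open>n\<close> and
  \<open>- n\<close> are opposite, so the odd terms of an even sequence cancel; on even indices the
  twist is the alternating sign.\<close>

lemma infsum_imaginary_twist: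
  assumes f: "geo_bounded f" "\<And>n. f (- n) = f n"
  shows "(\<Sum>\<^sub>\<infinity>n. \<i> powi n * f n) = (\<Sum>\<^sub>\<infinity>n. alt n * f (2 * n))"
proof -
  have i2: "\<i> powi (2 * n) = alt n" for n
    by (simp add: power_int_mult alt_def power_int_minus_left)
  have ni: "norm (\<i> powi n) = 1" for n by (simp add: norm_power_int)
  define g where "g = (\<lambda>n. if even n then \<i> powi n * f n else 0)"
  define h where "h = (\<lambda>n. if odd n then \<i> powi n * f n else 0)"
  have "geo_bounded (\<lambda>n. (if even n then \<i> powi n else 0) * f n)"
    by (rule geo_bounded_bounded_mult[OF f(1), of _ 1]) (auto simp: ni)
  moreover have "(\<lambda>n. (if even n then \<i> powi n else 0) * f n) = g" by (auto simp: g_def)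
  ultimately have g: "g summable_on UNIV" using geo_bounded_summable by metis
  have "geo_bounded (\<lambda>n. (if odd n then \<i> powi n else 0) * f n)"
    by (rule geo_bounded_bounded_mult[OF f(1), of _ 1]) (auto simp: ni)
  moreover have "(\<lambda>n. (if odd n then \<i> powi n else 0) * f n) = h" by (auto simp: h_def)
  ultimately have h: "h summable_on UNIV" using geo_bounded_summable by metis
  have "(\<Sum>\<^sub>\<infinity>n. \<i> powi n * f n) = (\<Sum>\<^sub>\<infinity>n. g n + h n)"
    by (intro infsum_cong) (auto simp: g_def h_def)
  also have "\<dots> = infsum g UNIV + infsum h UNIV" by (rule infsum_add[OF g h])
  also have "infsum h UNIV = 0"
  proof (rule infsum_odd_int_0)
    show "h (- n) = - h n" for n
    proof (cases "odd n")
      case True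
      then obtain k where n: "n = 2 * k + 1" by (rule oddE)
      have "\<i> powi n = alt k * \<i>" unfolding n by (simp add: power_int_add i2)
      moreover have "\<i> powi (- n) = - (alt k * \<i>)"
      proof -
        have "- n = 2 * (- k - 1) + 1" using n by simp
        hence "\<i> powi (- n) = \<i> powi (2 * (- k - 1) + 1)" by (simp only:)
        also have "\<dots> = alt (- k - 1) * \<i>" by (subst power_int_add) (simp_all only: i2, simp_all)
        also have "alt (- k - 1) = - alt k" by (simp add: alt_def)
        finally show ?thesis by simp
      qed
      ultimately show ?thesis using True by (simp add: h_def f(2))
    qed (simp add: h_def)
  qed
  also have "infsum g UNIV = infsum g (range (\<lambda>n. 2 * n))"
    by (rule infsum_cong_neutral) (auto simp: g_def elim!: evenE)
  also have "\<dots> = (\<Sum>\<^sub>\<infinity>n. g (2 * n))"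
    by (subst infsum_reindex) (auto simp: inj_def o_def)
  finally show ?thesis by (simp add: g_def i2)
qed

section \<open>Behaviour near q = 0 and the orbit of q under q \<mapsto> - q^2\<close>

lemma norm_infsum_int_minus_0_le:
  fixes q :: complex and f :: "int \<Rightarrow> complex"
  assumes q: "norm q \<le> 1 / 2" and f: "\<And>n. norm (f n) \<le> 2 * norm q ^ nat \<bar>n\<bar>"
  shows "norm (infsum f UNIV - f 0) \<le> 4 * (\<Sum>\<^sub>\<infinity>n::int. (1 / 2) ^ nat \<bar>n\<bar>) * norm q"
proof -
  have "geo_bounded f" by (rule geo_boundedI[OF norm_ge_zero _ f]) (use q in auto)
  hence s: "f summable_on UNIV" by (rule geo_bounded_summable)
  define g where "g = (\<lambda>n. if n = 0 then 0 else f n)"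
  have "(f has_sum infsum f UNIV) UNIV" using s by simp
  moreover have "((\<lambda>n. if n = 0 then - f 0 else 0) has_sum - f 0) UNIV"
    by (rule has_sum_finite_neutralI[of "{0}"]) auto
  ultimately have "((\<lambda>n. f n + (if n = 0 then - f 0 else 0)) has_sum infsum f UNIV + - f 0) UNIV"
    by (rule has_sum_add)
  moreover have "(\<lambda>n. f n + (if n = 0 then - f 0 else 0)) = g" by (auto simp: g_def)
  ultimately have g: "(g has_sum infsum f UNIV - f 0) UNIV" by simp
  have gn: "norm (g n) \<le> 4 * norm q * (1 / 2) ^ nat \<bar>n\<bar>" for n
  proof (cases "n = 0")
    case False
    then obtain k where k: "nat \<bar>n\<bar> = Suc k" by (metis nat_0_iff abs_le_zero_iff not0_implies_Suc)
    \<comment> \<open>One factor \<open>norm q\<close> is split off for the linear bound; replacing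
      the remaining ones by 1/2 makes the majorant independent of \<open>q\<close> and turns the 2
      into a 4.\<close>
    have "norm (g n) \<le> 2 * (norm q * norm q ^ k)" using f[of n] False k by (simp add: g_def)
    also have "\<dots> \<le> 2 * (norm q * (1 / 2) ^ k)"
      using q by (intro mult_left_mono power_mono) auto
    finally show ?thesis by (simp add: k)
  qed (simp add: g_def)
  have "((\<lambda>n::int. 4 * norm q * (1 / 2) ^ nat \<bar>n\<bar>) has_sum 4 * norm q * (\<Sum>\<^sub>\<infinity>n::int. (1 / 2) ^ nat \<bar>n\<bar>)) UNIV"
    by (intro has_sum_cmult_right has_sum_infsum summable_on_int_geometric) auto
  from norm_infsum_le[OF g this gn] show ?thesis by (simp add: mult_ac)
qed

lemma norm_theta_minus_1_le:
  assumes "q \<noteq> 0" "norm q \<le> 1 / 2"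
  shows "norm (theta q - 1) \<le> 4 * (\<Sum>\<^sub>\<infinity>n::int. (1 / 2) ^ nat \<bar>n\<bar>) * norm q"
proof -
  have "norm (q powi (n\<^sup>2)) \<le> 2 * norm q ^ nat \<bar>n\<bar>" for n
  proof -
    have "norm (q powi (n\<^sup>2)) = norm q ^ nat (n\<^sup>2)" by (simp add: power_int_def norm_power)
    also have "\<dots> \<le> norm q ^ nat \<bar>n\<bar>"
      using assms abs_le_square_int[of n] by (intro power_decreasing) auto
    also have "\<dots> \<le> 2 * norm q ^ nat \<bar>n\<bar>" by simp
    finally show ?thesis .
  qed
  from norm_infsum_int_minus_0_le[OF assms(2) this] show ?thesis by (simp add: theta_def)
qed

lemma norm_dn_sum_minus_half_le:
  assumes "q \<noteq> 0" "norm q \<le> 1 / 2"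
  shows "norm (dn_sum q - 1 / 2) \<le> 4 * (\<Sum>\<^sub>\<infinity>n::int. (1 / 2) ^ nat \<bar>n\<bar>) * norm q"
proof -
  have "norm (dn_coeff q n) \<le> 2 * norm q ^ nat \<bar>n\<bar>" for n
  proof -
    have "norm (dn_coeff q n) \<le> 1 / (1 - norm q) * norm q ^ nat \<bar>n\<bar>"
      unfolding dn_coeff_def by (rule norm_inverse_den_le) (use assms in auto)
    also have "\<dots> \<le> 2 * norm q ^ nat \<bar>n\<bar>"
      using assms by (intro mult_right_mono) (auto simp: divide_simps)
    finally show ?thesis .
  qed
  from norm_infsum_int_minus_0_le[OF assms(2) this]
  show ?thesis by (simp add: dn_sum_def dn_coeff_def[of _ 0] den_def)
qed

lemma tendsto_of_linear_bound:
  fixes f :: "complex \<Rightarrow> complex"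
  assumes f: "\<And>q. q \<noteq> 0 \<Longrightarrow> norm q \<le> 1 / 2 \<Longrightarrow> norm (f q - l) \<le> C * norm q"
    and s: "s \<longlonglongrightarrow> 0" "\<And>k. s k \<noteq> 0"
  shows "(\<lambda>k. f (s k)) \<longlonglongrightarrow> l"
proof -
  have "eventually (\<lambda>k. norm (s k) < 1 / 2) sequentially"
    using tendstoD[OF s(1), of "1 / 2"] by simp
  hence "eventually (\<lambda>k. norm (f (s k) - l) \<le> C * norm (s k)) sequentially"
    by eventually_elim (use f s in auto)
  moreover have "(\<lambda>k. C * norm (s k)) \<longlonglongrightarrow> 0"
    using s(1) by (auto intro!: tendsto_eq_intros)
  ultimately have "(\<lambda>k. f (s k) - l) \<longlonglongrightarrow> 0" by (rule Lim_null_comparison)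
  thus ?thesis by (simp add: LIM_zero_iff)
qed

text \<open>Index \<open>k\<close> is the iterate number \<open>k + 1\<close> of
  \<open>q \<mapsto> - q\<^sup>2\<close>; squaring removes the sign each time, so only one
  remains.\<close>

definition nome_iterate :: "complex \<Rightarrow> nat \<Rightarrow> complex" where
  "nome_iterate q k = - (q ^ 2 ^ Suc k)"

context
  fixes q :: complex
  assumes q: "q \<noteq> 0" "norm q < 1"
begin

lemma nome_iterate_Suc: "nome_iterate q (Suc k) = - ((nome_iterate q k)\<^sup>2)"
  by (simp add: nome_iterate_def power_mult [symmetric] mult_ac)

lemma nome_iterate_nz: "nome_iterate q k \<noteq> 0" using q by (simp add: nome_iterate_def)

lemma nome_iterate_less_1: "norm (nome_iterate q k) < 1"
  using q by (simp add: nome_iterate_def norm_power power_less_one_iff)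

lemma nome_iterate_tendsto: "nome_iterate q \<longlonglongrightarrow> 0"
proof (rule Lim_null_comparison)
  show "eventually (\<lambda>k. norm (nome_iterate q k) \<le> norm q ^ k) sequentially"
  proof (rule always_eventually, rule allI)
    fix k
    have "k \<le> 2 ^ Suc k" by (metis less_exp less_imp_le_nat Suc_leD)
    thus "norm (nome_iterate q k) \<le> norm q ^ k"
      unfolding nome_iterate_def norm_minus_cancel norm_power
      using q by (intro power_decreasing) auto
  qed
  show "(\<lambda>k. norm q ^ k) \<longlonglongrightarrow> 0" using q by (intro LIMSEQ_power_zero) auto
qed

text \<open>A zero at \<open>q\<close> would spread along the whole orbit, since the square of theta
  at \<open>- (q\<^sup>2)\<close> has \<open>theta q\<close> as a factor; but theta tends to 1
  there.\<close>

lemma theta_nonzero: "theta q \<noteq> 0"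
proof
  assume 0: "theta q = 0"
  have "theta (nome_iterate q k) = 0" for k
  proof (induction k)
    case 0
    show ?case using theta_mult_theta_minus[OF q] \<open>theta q = 0\<close> by (simp add: nome_iterate_def)
  next
    case (Suc k)
    thus ?case using theta_mult_theta_minus[OF nome_iterate_nz nome_iterate_less_1, of k]
      by (simp add: nome_iterate_Suc)
  qed
  moreover have "(\<lambda>k. theta (nome_iterate q k)) \<longlonglongrightarrow> 1"
    by (rule tendsto_of_linear_bound[OF norm_theta_minus_1_le nome_iterate_tendsto nome_iterate_nz])
  ultimately show False by (simp add: LIMSEQ_const_iff)
qed

end

text \<open>The product of the Fourier series of \<open>dn\<close> and \<open>\<theta>\<^sub>4\<close> is a multiple of that of \<open>\<theta>\<^sub>3\<close>; the constant is
  read off at \<open>z = \<i>\<close>, where the two theta series agree.\<close>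

lemma theta_minus_mult_dn_sum:
  assumes q: "q \<noteq> 0" "norm q < 1"
  shows "theta (- q) * dn_sum q = dn_sum (- (q\<^sup>2)) * theta q"
proof -
  let ?A = "conv (\<lambda>n. alt n * q powi (n\<^sup>2)) (dn_coeff q) 0"
  have *: "theta (- q) = (\<Sum>\<^sub>\<infinity>n. alt n * q powi (n\<^sup>2))"
  proof -
    have "alt (n\<^sup>2) = alt n" for n by (simp add: alt_def)
    thus ?thesis by (simp add: theta_def minus_powi)
  qed
  have 1: "theta (- q) * dn_sum q = ?A * theta q"
    unfolding * using theta_dn_twisted[OF q, of "\<lambda>_. 1"] by (simp add: dn_sum_def theta_def)
  let ?t = "\<Sum>\<^sub>\<infinity>n. alt n * q powi ((2 * n)\<^sup>2)"
  have q4: "- (q ^ 4) \<noteq> 0" "norm (- (q ^ 4)) < 1"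
    using q by (auto simp: norm_power power_less_one_iff)
  have "theta (- (q ^ 4)) = ?t"
  proof -
    have "alt (n\<^sup>2) = alt n" for n by (simp add: alt_def)
    moreover have "(q ^ 4) powi (n\<^sup>2) = q powi ((2 * n)\<^sup>2)" for n
      using power_int_mult[of q 4 "n\<^sup>2"] by (simp add: power_mult_distrib)
    ultimately show ?thesis by (simp add: theta_def minus_powi)
  qed
  hence t: "?t \<noteq> 0" using theta_nonzero[OF q4] by simp
  have "(\<Sum>\<^sub>\<infinity>n. \<i> powi n * (alt n * q powi (n\<^sup>2))) = (\<Sum>\<^sub>\<infinity>n. alt n * (alt (2 * n) * q powi ((2 * n)\<^sup>2)))"
    by (rule infsum_imaginary_twist[OF geo_bounded_alt_theta[OF q]]) (simp add: alt_uminus)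
  hence a: "(\<Sum>\<^sub>\<infinity>n. \<i> powi n * (alt n * q powi (n\<^sup>2))) = ?t"
    by (simp add: alt_def[of "2 * _"])
  have b: "(\<Sum>\<^sub>\<infinity>n. \<i> powi n * q powi (n\<^sup>2)) = ?t"
    by (rule infsum_imaginary_twist[OF geo_bounded_theta[OF q]]) simp
  have "(\<Sum>\<^sub>\<infinity>n. \<i> powi n * dn_coeff q n) = (\<Sum>\<^sub>\<infinity>n. alt n * dn_coeff q (2 * n))"
    by (rule infsum_imaginary_twist[OF geo_bounded_dn[OF q]]) (rule dn_coeff_uminus)
  also have "\<dots> = dn_sum (- (q\<^sup>2))"
    by (simp add: dn_sum_def dn_coeff_double dn_coeff_minus[abs_def])
  finally have "?t * dn_sum (- (q\<^sup>2)) = ?A * ?t"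
    using theta_dn_twisted[OF q, of "\<lambda>n. \<i> powi n"] a b
    by (simp add: power_int_add norm_power_int)
  hence "dn_sum (- (q\<^sup>2)) = ?A" using t by simp
  thus ?thesis using 1 by simp
qed

text \<open>The quotient of \<open>dn_sum\<close> by the square of theta is invariant under
  \<open>q \<mapsto> - q\<^sup>2\<close>, so it equals its limit 1/2 along the orbit. This is the
  Lambert series behind the theorem on sums of two squares.\<close>

lemma dn_sum_eq_theta:
  assumes q: "q \<noteq> 0" "norm q < 1"
  shows "dn_sum q = theta q ^ 2 / 2"
proof -
  have step: "dn_sum q / theta q ^ 2 = dn_sum (- (q\<^sup>2)) / theta (- (q\<^sup>2)) ^ 2"
    if "q \<noteq> 0" "norm q < 1" for q
  proof -
    have "dn_sum q * theta (- (q\<^sup>2)) ^ 2 = dn_sum (- (q\<^sup>2)) * theta q ^ 2"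
      using theta_minus_mult_dn_sum[OF that] theta_mult_theta_minus[OF that] by Groebner_Basis.algebra
    thus ?thesis
      using theta_nonzero[OF that] theta_nonzero[OF square_nome(3,4)[OF that]] by (simp add: frac_eq_eq)
  qed
  have it: "dn_sum (nome_iterate q k) / theta (nome_iterate q k) ^ 2 = dn_sum q / theta q ^ 2" for k
  proof (induction k)
    case 0
    show ?case using step[OF q] by (simp add: nome_iterate_def)
  next
    case (Suc k)
    thus ?case using step[OF nome_iterate_nz[OF q] nome_iterate_less_1[OF q], of k]
      by (simp add: nome_iterate_Suc[OF q])
  qed
  have "(\<lambda>k. dn_sum (nome_iterate q k) / theta (nome_iterate q k) ^ 2) \<longlonglongrightarrow> (1 / 2) / 1 ^ 2"
    by (intro tendsto_intros tendsto_of_linear_bound[OF norm_theta_minus_1_le nome_iterate_tendsto[OF q] nome_iterate_nz[OF q]]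
        tendsto_of_linear_bound[OF norm_dn_sum_minus_half_le nome_iterate_tendsto[OF q] nome_iterate_nz[OF q]]) auto
  hence "dn_sum q / theta q ^ 2 = 1 / 2" by (simp add: it LIMSEQ_const_iff)
  thus ?thesis using theta_nonzero[OF q] by (simp add: field_simps)
qed

text \<open>The exponent is invariant under \<open>n \<mapsto> - 1 - n\<close>, so both halves of
  the integers contribute equally.\<close>

lemma theta_tri_eq_triangle_series:
  assumes q: "q \<noteq> 0" "norm q < 1"
  shows "theta_tri q = 2 * triangle_series (q\<^sup>2)"
proof -
  define f where "f = (\<lambda>n::int. q powi (n * (n + 1)))"
  have s: "f summable_on UNIV"
    unfolding f_def by (intro geo_bounded_summable geo_bounded_theta_tri q)
  have U: "UNIV = range int \<union> range (\<lambda>n. - 1 - int n)" "range int \<inter> range (\<lambda>n. - 1 - int n) = {}"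
  proof -
    have "x \<in> range int \<union> range (\<lambda>n. - 1 - int n)" for x
    proof (cases "x \<ge> 0")
      case True
      hence "x = int (nat x)" by simp
      thus ?thesis by blast
    next
      case False
      hence "x = - 1 - int (nat (- 1 - x))" by simp
      thus ?thesis by blast
    qed
    thus "UNIV = range int \<union> range (\<lambda>n. - 1 - int n)" by blast
  qed auto
  have i1: "f (int n) = (q\<^sup>2) ^ (n * (n + 1) div 2)" for n
  proof -
    have "even (n * (n + 1))" by simp
    hence "2 * (n * (n + 1) div 2) = n * (n + 1)" by (rule dvd_mult_div_cancel)
    hence "(q\<^sup>2) ^ (n * (n + 1) div 2) = q ^ (n * (n + 1))" by (simp only: power_mult [symmetric])
    moreover have "f (int n) = q powi int (n * (n + 1))" by (simp add: f_def algebra_simps)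
    ultimately show ?thesis by (simp only: power_int_of_nat)
  qed
  have i2: "f (- 1 - int n) = f (int n)" for n by (simp add: f_def algebra_simps)
  have "infsum f UNIV = infsum f (range int) + infsum f (range (\<lambda>n. - 1 - int n))"
    using infsum_Un_disjoint[OF summable_on_subset_banach[OF s] summable_on_subset_banach[OF s] U(2)] U(1) by simp
  also have "infsum f (range int) = (\<Sum>\<^sub>\<infinity>n. f (int n))"
    by (subst infsum_reindex) (auto simp: o_def)
  also have "infsum f (range (\<lambda>n. - 1 - int n)) = (\<Sum>\<^sub>\<infinity>n. f (int n))"
    by (subst infsum_reindex) (auto simp: o_def i2 inj_def)
  also have "(\<Sum>\<^sub>\<infinity>n. f (int n)) = (\<Sum>n. f (int n))"
  proof -
    have "f summable_on range int" by (rule summable_on_subset_banach[OF s]) simp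
    hence "(\<lambda>n. f (int n)) summable_on UNIV"
      by (subst (asm) summable_on_reindex) (auto simp: o_def)
    hence "((\<lambda>n. f (int n)) has_sum (\<Sum>\<^sub>\<infinity>n. f (int n))) UNIV" by simp
    thus ?thesis using has_sum_imp_sums sums_unique by blast
  qed
  finally show ?thesis by (simp add: theta_tri_def f_def [symmetric] triangle_series_def i1)
qed

text \<open>The denominator 16 collected from the halves cancels against \<open>2 ^ 4\<close> from
  the fourth power of \<open>theta_tri Q\<close>.\<close>

lemma dn_sum_square_diff:
  assumes Q: "Q \<noteq> 0" "norm Q < 1"
  shows "(dn_sum Q ^ 2 - dn_sum (- Q) ^ 2) / 4 = Q * triangle_series (Q\<^sup>2) ^ 4"
proof -
  have "(dn_sum Q ^ 2 - dn_sum (- Q) ^ 2) / 4 = (theta Q ^ 4 - theta (- Q) ^ 4) / 16"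
    unfolding dn_sum_eq_theta[OF Q] dn_sum_eq_theta[OF minus_nome[OF Q]]
    by (simp add: power_divide diff_divide_distrib)
  thus ?thesis
    using theta_fourth_power_diff[OF Q] theta_tri_eq_triangle_series[OF Q]
    by (simp add: power_mult_distrib)
qed

section \<open>Hankel determinants of even derivatives\<close>

lemma fps_power_nth_order_2:
  fixes \<phi> :: "complex fps"
  assumes "fps_nth \<phi> 0 = 0" "fps_nth \<phi> 1 = 0"
  shows "(n < 2 * k \<longrightarrow> fps_nth (\<phi> ^ k) n = 0) \<and> fps_nth (\<phi> ^ k) (2 * k) = fps_nth \<phi> 2 ^ k"
proof (induction k arbitrary: n)
  case (Suc k)
  have 0: "fps_nth \<phi> i = 0" if "i < 2" for i
    using that assms by (cases i) (auto simp: less_Suc_eq numeral_2_eq_2)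
  have *: "fps_nth \<phi> i * fps_nth (\<phi> ^ k) (n - i) = 0" if "n < 2 * Suc k \<or> n = 2 * Suc k \<and> i \<noteq> 2" "i \<le> n" for i n
    using that 0[of i] Suc.IH[of "n - i"] by (cases "i < 2") auto
  have "fps_nth (\<phi> ^ Suc k) n = 0" if "n < 2 * Suc k"
    using that * by (auto simp: fps_mult_nth intro!: sum.neutral)
  moreover have "fps_nth (\<phi> ^ Suc k) (2 * Suc k) = fps_nth \<phi> 2 ^ Suc k"
  proof -
    have "fps_nth (\<phi> ^ Suc k) (2 * Suc k) =
        (\<Sum>i=0..2 * Suc k. fps_nth \<phi> i * fps_nth (\<phi> ^ k) (2 * Suc k - i))"
      by (simp only: power_Suc fps_mult_nth)
    also have "\<dots> = (\<Sum>i\<in>{2}. fps_nth \<phi> i * fps_nth (\<phi> ^ k) (2 * Suc k - i))"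
      by (rule sum.mono_neutral_right) (use * in auto)
    finally show ?thesis using Suc.IH by simp
  qed
  ultimately show ?case by simp
qed simp

text \<open>A triangular factorisation stated entrywise; it serves the Hankel matrix and, through
  the Newton basis, the Vandermonde matrix.\<close>

lemma det_mult_triangular:
  fixes u v :: "nat \<Rightarrow> nat \<Rightarrow> 'a :: idom"
  assumes "\<And>i k. i < k \<Longrightarrow> u i k = 0" "\<And>j k. j < k \<Longrightarrow> v k j = 0"
    and H: "\<And>i j. i < n \<Longrightarrow> j < n \<Longrightarrow> H i j = (\<Sum>k<n. u i k * v k j)"
  shows "det (mat n n (\<lambda>(i, j). H i j)) = (\<Prod>i<n. u i i * v i i)"
proof -
  let ?U = "mat n n (\<lambda>(i, j). u i j)" and ?V = "mat n n (\<lambda>(i, j). v i j)"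
  have "mat n n (\<lambda>(i, j). H i j) = ?U * ?V"
    by (rule eq_matI) (auto simp: scalar_prod_def H lessThan_atLeast0)
  hence "det (mat n n (\<lambda>(i, j). H i j)) = det ?U * det ?V"
    by (simp add: det_mult[of _ n])
  also have "det ?U = (\<Prod>i<n. u i i)"
    by (subst det_lower_triangular[of n])
       (auto simp: assms prod_list_diag_prod lessThan_atLeast0)
  also have "det ?V = (\<Prod>i<n. v i i)"
    by (subst det_upper_triangular[of _ n])
       (auto simp: assms upper_triangular_def prod_list_diag_prod lessThan_atLeast0)
  finally show ?thesis by (simp add: prod.distrib)
qed

text \<open>Coefficients of the even derivatives of \<open>\<phi>\<close> as polynomials in \<open>\<phi>\<close>: on powers of \<open>\<phi>\<close> the
  second derivative acts as a tridiagonal matrix.\<close>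

fun deriv_coeff :: "complex \<Rightarrow> complex \<Rightarrow> nat \<Rightarrow> nat \<Rightarrow> complex" where
  "deriv_coeff a c 0 k = (if k = 1 then 1 else 0)"
| "deriv_coeff a c (Suc n) k =
     (if k = 0 then 0 else of_nat ((k - 1) * (4 * (k - 1) + 2)) * deriv_coeff a c n (k - 1)) +
     a * of_nat (k\<^sup>2) * deriv_coeff a c n k +
     c * of_nat ((k + 1) * (4 * k + 2)) * deriv_coeff a c n (k + 1)"

lemma deriv_coeff_eq_0: "k > Suc n \<Longrightarrow> deriv_coeff a c n k = 0"
  by (induction n arbitrary: k) auto

lemma deriv_coeff_top: "deriv_coeff a c n (Suc n) = fact (2 * n + 1)"
proof (induction n)
  case (Suc n)
  have "deriv_coeff a c (Suc n) (Suc (Suc n)) = of_nat (Suc n * (4 * Suc n + 2)) * deriv_coeff a c n (Suc n)"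
    by (simp add: deriv_coeff_eq_0)
  also have "\<dots> = of_nat (Suc n * (4 * Suc n + 2)) * fact (2 * n + 1)"
    by (simp only: Suc.IH)
  \<comment> \<open>The leading factor is \<open>(2 * n + 2) * (2 * n + 3)\<close>.\<close>
  also have "\<dots> = fact (2 * Suc n + 1)"
    by (simp add: algebra_simps)
  finally show ?case .
qed simp

context
  fixes \<phi> :: "complex fps" and a c :: complex
  assumes \<phi>0: "fps_nth \<phi> 0 = 0" "fps_nth (fps_deriv \<phi>) 0 = 0"
    and \<phi>1: "fps_deriv \<phi> ^ 2 = 4 * \<phi> ^ 3 + fps_const a * \<phi> ^ 2 + 4 * fps_const c * \<phi>"
    and \<phi>2: "fps_deriv (fps_deriv \<phi>) = 6 * \<phi> ^ 2 + fps_const a * \<phi> + 2 * fps_const c"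
begin

text \<open>Twofold differentiation gives \<open>(k + 1) * \<phi> ^ k\<close> times the second
  derivative plus \<open>(k + 1) * k * \<phi> ^ (k - 1)\<close> times the square of the first. The
  differential equations combine 6 + 4k, 1 + k and 2 + 4k into the three coefficients.\<close>

lemma second_deriv_power:
  "fps_deriv (fps_deriv (\<phi> ^ Suc k)) = of_nat (Suc k * (4 * Suc k + 2)) * \<phi> ^ Suc (Suc k) +
     fps_const a * of_nat ((Suc k)\<^sup>2) * \<phi> ^ Suc k + fps_const c * of_nat (Suc k * (4 * k + 2)) * \<phi> ^ k"
proof (cases k)
  case 0
  thus ?thesis using \<phi>2 by (simp add: power2_eq_square algebra_simps)
next
  case (Suc j)
  have n0: "fps_deriv (of_nat x :: complex fps) = 0" for x
    by (simp add: fps_of_nat [symmetric])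
  have dpow: "fps_deriv (\<phi> ^ Suc n) = of_nat (Suc n) * (\<phi> ^ n * fps_deriv \<phi>)" for n
    by (simp only: fps_deriv_power fps_of_nat diff_Suc_1 mult_ac)
  have "fps_deriv (fps_deriv (\<phi> ^ Suc k)) =
      of_nat (Suc k) * (\<phi> ^ k * fps_deriv (fps_deriv \<phi>)) +
      of_nat (Suc k) * of_nat k * (\<phi> ^ j * fps_deriv \<phi> ^ 2)"
    unfolding dpow fps_deriv_mult Suc n0
    by (simp only: mult_zero_left add_0_right distrib_left power2_eq_square mult_ac)
  also have "\<dots> = of_nat (Suc k * (4 * Suc k + 2)) * \<phi> ^ Suc (Suc k) +
     fps_const a * of_nat ((Suc k)\<^sup>2) * \<phi> ^ Suc k + fps_const c * of_nat (Suc k * (4 * k + 2)) * \<phi> ^ k"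
    unfolding \<phi>1 \<phi>2 Suc
    by (simp add: power2_eq_square power3_eq_cube algebra_simps)
  finally show ?thesis .
qed

lemma even_deriv_eq_sum:
  "(fps_deriv ^^ (2 * n)) \<phi> = (\<Sum>k\<le>Suc n. fps_const (deriv_coeff a c n k) * \<phi> ^ k)"
proof (induction n)
  case 0
  show ?case by simp
next
  case (Suc n)
  define d where "d = deriv_coeff a c n"
  have d0: "d k = 0" if "k > Suc n" for k using that by (simp add: d_def deriv_coeff_eq_0)
  have "(fps_deriv ^^ (2 * Suc n)) \<phi> = fps_deriv (fps_deriv ((fps_deriv ^^ (2 * n)) \<phi>))"
    by simp
  also have "\<dots> = (\<Sum>k\<le>Suc n. fps_const (d k) * fps_deriv (fps_deriv (\<phi> ^ k)))"
    unfolding Suc.IH d_def[symmetric] by (simp add: fps_deriv_sum del: sum.atMost_Suc)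
  also have "\<dots> = (\<Sum>k\<le>n. fps_const (d (Suc k)) * fps_deriv (fps_deriv (\<phi> ^ Suc k)))"
    by (subst sum.atMost_Suc_shift) simp
  also have "\<dots> = (\<Sum>k\<le>n. fps_const (of_nat (Suc k * (4 * Suc k + 2)) * d (Suc k)) * \<phi> ^ Suc (Suc k)) +
      (\<Sum>k\<le>n. fps_const (a * of_nat ((Suc k)\<^sup>2) * d (Suc k)) * \<phi> ^ Suc k) +
      (\<Sum>k\<le>n. fps_const (c * of_nat (Suc k * (4 * k + 2)) * d (Suc k)) * \<phi> ^ k)"
    unfolding second_deriv_power sum.distrib [symmetric]
    by (intro sum.cong refl)
       (simp add: distrib_left fps_const_mult [symmetric] fps_of_nat mult_ac del: fps_const_mult of_nat_power of_nat_mult of_nat_add power_Suc of_nat_Suc mult_Suc mult_Suc_right)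
  also have "(\<Sum>k\<le>n. fps_const (of_nat (Suc k * (4 * Suc k + 2)) * d (Suc k)) * \<phi> ^ Suc (Suc k)) =
     (\<Sum>k\<le>Suc (Suc n). fps_const (if k = 0 then 0 else of_nat ((k - 1) * (4 * (k - 1) + 2)) * d (k - 1)) * \<phi> ^ k)"
    by (subst sum.atMost_Suc_shift, subst sum.atMost_Suc_shift) simp
  also have "(\<Sum>k\<le>n. fps_const (a * of_nat ((Suc k)\<^sup>2) * d (Suc k)) * \<phi> ^ Suc k) =
     (\<Sum>k\<le>Suc (Suc n). fps_const (a * of_nat (k\<^sup>2) * d k) * \<phi> ^ k)"
    by (subst sum.atMost_Suc, subst sum.atMost_Suc_shift) (simp add: d0)
  also have "(\<Sum>k\<le>n. fps_const (c * of_nat (Suc k * (4 * k + 2)) * d (Suc k)) * \<phi> ^ k) =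
     (\<Sum>k\<le>Suc (Suc n). fps_const (c * of_nat ((k + 1) * (4 * k + 2)) * d (k + 1)) * \<phi> ^ k)"
    by (simp add: d0)
  finally show ?case
    unfolding d_def deriv_coeff.simps sum.distrib [symmetric] distrib_right [symmetric] fps_const_add .
qed

text \<open>Of the \<open>2 * (i + j + 1)\<close> derivatives, the first \<open>2 * j\<close> are
  expanded in powers of \<open>\<phi>\<close> up to \<open>j + 1\<close>, and the other
  \<open>2 * i + 2\<close> read off a Taylor coefficient, which is 0 for powers beyond
  \<open>i + 1\<close> as \<open>\<phi>\<close> vanishes to order two. Both factors are
  triangular.\<close>

lemma det_hankel_even_derivs:
  "det (mat m m (\<lambda>(i, j). fact (2 * (i + j + 1)) * fps_nth \<phi> (2 * (i + j + 1)))) =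
     (\<Prod>i<m. c ^ Suc i * fact (2 * i + 2) * fact (2 * i + 1))"
proof -
  have \<phi>10: "fps_nth \<phi> 1 = 0" using \<phi>0(2) by simp
  have "fps_nth (fps_deriv (fps_deriv \<phi>)) 0 = 2 * c"
    unfolding \<phi>2 using \<phi>0(1) by (simp add: fps_nth_power_0 numeral_fps_const)
  hence \<phi>20: "fps_nth \<phi> 2 = c" by (simp add: numeral_2_eq_2)
  note pw = fps_power_nth_order_2[OF \<phi>0(1) \<phi>10, unfolded \<phi>20]
  define u where "u = (\<lambda>i k. fact (2 * i + 2) * fps_nth (\<phi> ^ Suc k) (2 * i + 2))"
  define v where "v = (\<lambda>k j. deriv_coeff a c j (Suc k))"
  have "det (mat m m (\<lambda>(i, j). fact (2 * (i + j + 1)) * fps_nth \<phi> (2 * (i + j + 1)))) = (\<Prod>i<m. u i i * v i i)"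
  proof (rule det_mult_triangular[where u = u and v = v and H = "\<lambda>i j. fact (2 * (i + j + 1)) * fps_nth \<phi> (2 * (i + j + 1))"])
    show "u i k = 0" if "i < k" for i k
      using pw[of "2 * i + 2" "Suc k"] that by (simp add: u_def)
    show "v k j = 0" if "j < k" for j k
      using that by (simp add: v_def deriv_coeff_eq_0)
    fix i j assume ij: "i < m" "j < m"
    have "fact (2 * (i + j + 1)) * fps_nth \<phi> (2 * (i + j + 1)) =
        fps_nth ((fps_deriv ^^ (2 * (i + j + 1))) \<phi>) 0"
      by (rule fps_0th_higher_deriv [symmetric])
    also have "\<dots> = fps_nth ((fps_deriv ^^ ((2 * i + 2) + 2 * j)) \<phi>) 0"
      by (rule arg_cong[where f = "\<lambda>n. fps_nth ((fps_deriv ^^ n) \<phi>) 0"]) simp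
    also have "\<dots> = fact (2 * i + 2) * fps_nth ((fps_deriv ^^ (2 * j)) \<phi>) (2 * i + 2)"
      by (simp only: funpow_add[of "2 * i + 2" "2 * j"] o_apply fps_0th_higher_deriv)
    also have "\<dots> = (\<Sum>k\<le>Suc j. fact (2 * i + 2) * (deriv_coeff a c j k * fps_nth (\<phi> ^ k) (2 * i + 2)))"
      by (simp only: even_deriv_eq_sum fps_sum_nth fps_mult_left_const_nth sum_distrib_left)
    \<comment> \<open>The power 0 drops out because the constant 1 has no coefficient of degree
      \<open>2 * i + 2\<close>; this explains the shift by \<open>Suc\<close> in \<open>u\<close>
      and \<open>v\<close>.\<close>
    also have "\<dots> = (\<Sum>k\<le>j. u i k * v k j)"
      by (subst sum.atMost_Suc_shift) (simp add: u_def v_def mult_ac)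
    also have "\<dots> = (\<Sum>k<m. u i k * v k j)"
      by (rule sum.mono_neutral_left) (use ij in \<open>auto simp: v_def deriv_coeff_eq_0\<close>)
    finally show "fact (2 * (i + j + 1)) * fps_nth \<phi> (2 * (i + j + 1)) = (\<Sum>k<m. u i k * v k j)" .
  qed
  also have "\<dots> = (\<Prod>i<m. c ^ Suc i * fact (2 * i + 2) * fact (2 * i + 1))"
  proof (rule prod.cong)
    fix i
    show "u i i * v i i = c ^ Suc i * fact (2 * i + 2) * fact (2 * i + 1)"
      using pw[of 0 "Suc i"] unfolding u_def v_def deriv_coeff_top by simp
  qed simp
  finally show ?thesis .
qed

end

section \<open>Vandermonde determinants and Lambert series\<close>

text \<open>For \<open>k \<le> n\<close> this is the complete homogeneous symmetric polynomial of
  degree \<open>n - k\<close> in \<open>x 0\<close>, ..., \<open>x k\<close>: the coordinates of a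
  monomial in the Newton basis.\<close>

fun newton_coeff :: "(nat \<Rightarrow> 'a :: comm_ring_1) \<Rightarrow> nat \<Rightarrow> nat \<Rightarrow> 'a" where
  "newton_coeff x 0 k = (if k = 0 then 1 else 0)"
| "newton_coeff x (Suc n) k = (if k = 0 then 0 else newton_coeff x n (k - 1)) + x k * newton_coeff x n k"

lemma newton_coeff_eq_0: "k > n \<Longrightarrow> newton_coeff x n k = 0"
  by (induction n arbitrary: k) auto

lemma newton_coeff_self: "newton_coeff x n n = 1"
  by (induction n) (auto simp: newton_coeff_eq_0)

lemma power_eq_newton_sum: "y ^ n = (\<Sum>k\<le>n. (\<Prod>l<k. y - x l) * newton_coeff x n k)"
proof (induction n)
  case (Suc n)
  let ?N = "\<lambda>k. \<Prod>l<k. y - x l"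
  have "y ^ Suc n = (\<Sum>k\<le>n. ?N k * y * newton_coeff x n k)"
    by (simp add: Suc sum_distrib_left mult_ac)
  also have "\<dots> = (\<Sum>k\<le>n. ?N (Suc k) * newton_coeff x n k) + (\<Sum>k\<le>n. ?N k * (x k * newton_coeff x n k))"
    unfolding sum.distrib [symmetric] by (intro sum.cong) (auto simp: algebra_simps)
  also have "(\<Sum>k\<le>n. ?N (Suc k) * newton_coeff x n k) =
      (\<Sum>k\<le>Suc n. ?N k * (if k = 0 then 0 else newton_coeff x n (k - 1)))"
    by (subst sum.atMost_Suc_shift) simp
  also have "(\<Sum>k\<le>n. ?N k * (x k * newton_coeff x n k)) = (\<Sum>k\<le>Suc n. ?N k * (x k * newton_coeff x n k))"
    by (simp add: newton_coeff_eq_0)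
  finally show ?case by (simp only: newton_coeff.simps distrib_left sum.distrib)
qed simp

text \<open>The Newton basis evaluated at its own nodes is lower triangular, and the change to
  monomials is triangular with diagonal 1.\<close>

lemma det_vandermonde:
  fixes x :: "nat \<Rightarrow> 'a :: idom"
  shows "det (mat n n (\<lambda>(i, j). x i ^ j)) = (\<Prod>j<n. \<Prod>i<j. x j - x i)"
proof -
  define u where "u = (\<lambda>i k. \<Prod>l<k. x i - x l)"
  define v where "v = (\<lambda>k j. newton_coeff x j k)"
  have "det (mat n n (\<lambda>(i, j). x i ^ j)) = (\<Prod>i<n. u i i * v i i)"
  proof (rule det_mult_triangular[where u = u and v = v and H = "\<lambda>i j. x i ^ j"])
    show "u i k = 0" if "i < k" for i k
      unfolding u_def using that by (intro prod_zero) auto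
    show "v k j = 0" if "j < k" for j k
      using that by (simp add: v_def newton_coeff_eq_0)
    fix i j assume ij: "i < n" "j < n"
    have "x i ^ j = (\<Sum>k\<le>j. u i k * v k j)"
      unfolding u_def v_def by (rule power_eq_newton_sum[of "x i" j x])
    also have "\<dots> = (\<Sum>k<n. u i k * v k j)"
      by (rule sum.mono_neutral_left) (use ij in \<open>auto simp: v_def newton_coeff_eq_0\<close>)
    finally show "x i ^ j = (\<Sum>k<n. u i k * v k j)" .
  qed
  thus ?thesis unfolding u_def v_def newton_coeff_self mult_1_right .
qed

abbreviation perms :: "nat \<Rightarrow> (nat \<Rightarrow> nat) set" where
  "perms m \<equiv> {p. p permutes {0..<m}}"

lemma det_Leibniz:
  "det (mat m m (\<lambda>(i, j). H i j)) = (\<Sum>p\<in>perms m. signof p * (\<Prod>i<m. H i (p i)))"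
proof -
  have "(\<Prod>i=0..<m. mat m m (\<lambda>(i, j). H i j) $$ (i, p i)) = (\<Prod>i<m. H i (p i))"
    if p: "p permutes {0..<m}" for p
  proof (rule prod.cong)
    fix i assume i: "i \<in> {..<m}"
    hence "p i < m" using permutes_in_image[OF p, of i] by simp
    thus "mat m m (\<lambda>(i, j). H i j) $$ (i, p i) = H i (p i)" using i by simp
  qed (simp add: lessThan_atLeast0)
  thus ?thesis by (subst det_def'[of _ m]) simp_all
qed

text \<open>Permuting the rows by \<open>s\<close> multiplies the determinant by the sign of
  \<open>s\<close>, which \<open>signof s\<close> cancels; all \<open>m!\<close> choices of
  \<open>s\<close> contribute the same Hankel determinant.\<close>

lemma sum_perms_pairs_eq_fact_det:
  fixes l :: "nat \<Rightarrow> complex"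
  shows "(\<Sum>(s, t)\<in>perms m \<times> perms m. signof s * signof t * (\<Prod>i<m. l (s i + t i))) =
    fact m * det (mat m m (\<lambda>(i, j). l (i + j)))"
proof -
  let ?A = "mat m m (\<lambda>(i, j). l (i + j))"
  have "(\<Sum>t\<in>perms m. signof s * signof t * (\<Prod>i<m. l (s i + t i))) = det ?A" if s: "s \<in> perms m" for s
  proof -
    have "s permutes {0..<m}" using s by simp
    from det_permute_rows[OF _ this, of ?A]
    have "det (mat m m (\<lambda>(i, j). ?A $$ (s i, j))) = signof s * det ?A" by simp
    moreover have "mat m m (\<lambda>(i, j). ?A $$ (s i, j)) = mat m m (\<lambda>(i, j). l (s i + j))"
    proof (rule eq_matI)
      fix i j assume ij: "i < dim_row (mat m m (\<lambda>(i, j). l (s i + j)))"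
        "j < dim_col (mat m m (\<lambda>(i, j). l (s i + j)))"
      hence "s i < m" using s permutes_in_image[of s "{0..<m}" i] by simp
      thus "mat m m (\<lambda>(i, j). ?A $$ (s i, j)) $$ (i, j) = mat m m (\<lambda>(i, j). l (s i + j)) $$ (i, j)"
        using ij by simp
    qed simp_all
    ultimately have "(\<Sum>t\<in>perms m. signof t * (\<Prod>i<m. l (s i + t i))) = signof s * det ?A"
      by (simp add: det_Leibniz)
    hence "(\<Sum>t\<in>perms m. signof s * signof t * (\<Prod>i<m. l (s i + t i))) = signof s * (signof s * det ?A)"
      by (simp only: sum_distrib_left [symmetric] mult.assoc)
    thus ?thesis by (simp add: sign_def)
  qed
  hence "(\<Sum>s\<in>perms m. \<Sum>t\<in>perms m. signof s * signof t * (\<Prod>i<m. l (s i + t i))) = (\<Sum>s\<in>perms m. det ?A)"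
    by (rule sum.cong[OF refl])
  also have "\<dots> = fact m * det ?A"
    using card_permutations[of "{0..<m}" m] by simp
  finally show ?thesis by (simp only: sum.cartesian_product)
qed

section \<open>Odd-power Lambert series over quadrants\<close>

definition lambert_term :: "complex \<Rightarrow> nat \<Rightarrow> int \<times> int \<Rightarrow> complex" where
  "lambert_term q e = (\<lambda>(k, r). q powi ((2 * k - 1) * r) * of_int r ^ e)"

definition lambert :: "complex \<Rightarrow> nat \<Rightarrow> complex" where
  "lambert q e = infsum (lambert_term q e) ({1..} \<times> {1..})"

context
  fixes q :: complex
  assumes q: "q \<noteq> 0" "norm q < 1"
begin

text \<open>For \<open>k, r \<ge> 1\<close> the exponent is at least \<open>k + r - 1\<close>, so a
  product of two one-variable series dominates.\<close>

lemma abs_summable_lambert_pos: "lambert_term q e abs_summable_on {1..} \<times> {1..}"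
proof -
  have g: "geo_bounded (\<lambda>n. q powi \<bar>n\<bar>)" by (rule geo_bounded_powi[OF q]) simp
  define f where "f = (\<lambda>(k, r). q powi \<bar>k\<bar> * (of_int r ^ e * q powi \<bar>r\<bar>))"
  have "f abs_summable_on UNIV \<times> UNIV"
    unfolding f_def
    by (rule abs_summable_times[OF geo_bounded_abs_summable[OF g]
          geo_bounded_abs_summable[OF geo_bounded_int_power_mult[OF g]]])
  hence "f abs_summable_on {1..} \<times> {1..}"
    by (rule summable_on_subset_banach) simp
  hence "(\<lambda>x. 1 / norm q * norm (f x)) summable_on {1..} \<times> {1..}"
    by (rule summable_on_cmult_right)
  thus ?thesis
  proof (rule summable_on_comparison_test)
    fix x :: "int \<times> int" assume "x \<in> {1..} \<times> {1..}"
    then obtain k r where x: "x = (k, r)" "k \<ge> 1" "r \<ge> 1" by auto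
    have "(- 1) + (k + r) \<le> r + (2 * (k - 1)) * 1" using x by simp
    also have "\<dots> \<le> r + (2 * (k - 1)) * r" using x by (intro add_left_mono mult_left_mono) auto
    also have "\<dots> = (2 * k - 1) * r" by (simp add: algebra_simps)
    finally have le: "(- 1) + (k + r) \<le> (2 * k - 1) * r" .
    have "norm (lambert_term q e x) = norm q powi ((2 * k - 1) * r) * norm (of_int r :: complex) ^ e"
      by (simp add: lambert_term_def x norm_mult norm_power norm_power_int)
    also have "\<dots> \<le> norm q powi ((- 1) + (k + r)) * norm (of_int r :: complex) ^ e"
      using le q by (intro mult_right_mono power_int_decreasing) auto
    also have "\<dots> = 1 / norm q * norm (f x)"
    proof -
      have nz: "norm q \<noteq> 0" using q by simp
      have "norm q powi ((- 1) + (k + r)) = 1 / norm q * (norm q powi k * norm q powi r)"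
        by (simp only: power_int_add[OF disjI1[OF nz]] power_int_minus1_right divide_inverse mult_1_left)
      thus ?thesis using x by (simp add: f_def norm_mult norm_power norm_power_int)
    qed
    finally show "norm (lambert_term q e x) \<le> 1 / norm q * norm (f x)" .
  qed simp
qed

lemma lambert_neg:
  assumes "odd e"
  shows "lambert_term q e abs_summable_on {..0} \<times> {..0}"
    and "infsum (lambert_term q e) ({..0} \<times> {..0}) = - lambert q e"
proof -
  define h where "h = (\<lambda>(k :: int, r :: int). (1 - k, - r))"
  \<comment> \<open>The reflected quadrant contains the additional line \<open>r = 0\<close>, on
    which the terms vanish since \<open>e\<close> is odd and hence positive.\<close>
  have bij: "bij_betw h ({1..} \<times> {0..}) ({..0} \<times> {..0})"
    by (rule bij_betwI[of _ _ _ h]) (auto simp: h_def)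
  have eq: "lambert_term q e (h x) = - lambert_term q e x" for x
    using assms by (auto simp: lambert_term_def h_def case_prod_unfold algebra_simps)
  have z: "lambert_term q e x = 0" if "x \<in> {1..} \<times> {0..} - {1..} \<times> {1..}" for x
  proof -
    have "snd x = 0" using that by (cases x) auto
    thus ?thesis using assms by (cases "e = 0") (auto simp: lambert_term_def case_prod_unfold)
  qed
  have "lambert_term q e abs_summable_on {1..} \<times> {0..} \<longleftrightarrow> lambert_term q e abs_summable_on {1..} \<times> {1..}"
    by (rule summable_on_cong_neutral) (use z in auto)
  hence "(\<lambda>x. norm (lambert_term q e (h x))) summable_on {1..} \<times> {0..}"
    using abs_summable_lambert_pos[of e] by (simp add: eq)
  thus "lambert_term q e abs_summable_on {..0} \<times> {..0}"
    by (subst (asm) summable_on_reindex_bij_betw[OF bij])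
  have "infsum (lambert_term q e) ({..0} \<times> {..0}) = (\<Sum>\<^sub>\<infinity>x\<in>{1..} \<times> {0..}. lambert_term q e (h x))"
    by (rule infsum_reindex_bij_betw[OF bij, symmetric])
  also have "\<dots> = - infsum (lambert_term q e) ({1..} \<times> {0..})"
    by (simp add: eq infsum_uminus)
  also have "infsum (lambert_term q e) ({1..} \<times> {0..}) = lambert q e"
    unfolding lambert_def by (rule infsum_cong_neutral) (use z in auto)
  finally show "infsum (lambert_term q e) ({..0} \<times> {..0}) = - lambert q e" .
qed

text \<open>For fixed \<open>r\<close> the sum over \<open>k\<close> is geometric with ratio
  \<open>q powi (2 * r)\<close>.\<close>

lemma lambert_eq: "lambert q e = (\<Sum>\<^sub>\<infinity>r\<in>{1..}. of_int r ^ e / den 1 q r)"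
proof -
  have sw: "bij_betw (\<lambda>(r, k). (k, r)) ({1..} \<times> {1..}) ({1::int..} \<times> {1::int..})"
    by (rule bij_betwI[of _ _ _ "\<lambda>(k, r). (r, k)"]) auto
  have sw': "(\<lambda>(r, k). lambert_term q e (k, r)) = (\<lambda>x. lambert_term q e (case x of (r, k) \<Rightarrow> (k, r)))"
    by auto
  have "lambert q e = infsum (\<lambda>(r, k). lambert_term q e (k, r)) ({1..} \<times> {1..})"
    unfolding lambert_def sw' by (rule infsum_reindex_bij_betw[OF sw, symmetric])
  also have "\<dots> = (\<Sum>\<^sub>\<infinity>r\<in>{1..}. \<Sum>\<^sub>\<infinity>k\<in>{1..}. lambert_term q e (k, r))"
  proof (rule infsum_Sigma'_banach [symmetric])
    have "lambert_term q e summable_on {1..} \<times> {1..}"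
      using abs_summable_summable abs_summable_lambert_pos by blast
    thus "(\<lambda>(r, k). lambert_term q e (k, r)) summable_on {1..} \<times> {1..}"
      unfolding sw' by (subst summable_on_reindex_bij_betw[OF sw])
  qed
  also have "\<dots> = (\<Sum>\<^sub>\<infinity>r\<in>{1..}. of_int r ^ e / den 1 q r)"
  proof (rule infsum_cong)
    fix r :: int assume r: "r \<in> {1..}"
    define z where "z = q powi (2 * r)"
    have nz: "norm z < 1" unfolding z_def using r by (intro norm_powi_lt_1 q) auto
    have "((\<lambda>n. z ^ n) has_sum (1 / (1 - z))) UNIV"
      using nz by (intro norm_summable_imp_has_sum geometric_sums) (auto simp: norm_power summable_geometric)
    hence "((\<lambda>n. (of_int r ^ e * q powi r) * z ^ n) has_sum ((of_int r ^ e * q powi r) * (1 / (1 - z)))) UNIV"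
      by (rule has_sum_cmult_right)
    moreover have "(of_int r ^ e * q powi r) * z ^ n = lambert_term q e (int n + 1, r)" for n
    proof -
      have "(2 * (int n + 1) - 1) * r = r + 2 * r * int n" by (simp add: algebra_simps)
      hence "q powi ((2 * (int n + 1) - 1) * r) = q powi r * z ^ n"
        unfolding z_def by (simp only: power_int_add[OF disjI1[OF q(1)]] power_int_mult power_int_of_nat)
      thus ?thesis by (simp add: lambert_term_def)
    qed
    moreover have "(of_int r ^ e * q powi r) * (1 / (1 - z)) = of_int r ^ e / den 1 q r"
    proof -
      have "den 1 q r \<noteq> 0" using den_nonzero[OF q, of 1 r] r by simp
      moreover have "1 - z \<noteq> 0" using nz by auto
      moreover have "q powi r * den 1 q r = 1 - z"
        unfolding den_def z_def using q by (simp add: right_diff_distrib power_int_add [symmetric])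
      ultimately have "q powi r / (1 - z) = 1 / den 1 q r" by (simp add: frac_eq_eq)
      hence "of_int r ^ e * (q powi r / (1 - z)) = of_int r ^ e * (1 / den 1 q r)" by (simp only:)
      thus ?thesis by simp
    qed
    ultimately have "((\<lambda>n. lambert_term q e (int n + 1, r)) has_sum (of_int r ^ e / den 1 q r)) UNIV"
      by simp
    moreover have "bij_betw (\<lambda>n. int n + 1) UNIV {1..}"
      by (rule bij_betwI[of _ _ _ "\<lambda>k. nat (k - 1)"]) auto
    ultimately have "((\<lambda>k. lambert_term q e (k, r)) has_sum (of_int r ^ e / den 1 q r)) {1..}"
      using has_sum_reindex_bij_betw[of "\<lambda>n. int n + 1" UNIV "{1..}" "\<lambda>k. lambert_term q e (k, r)"] by simp
    thus "(\<Sum>\<^sub>\<infinity>k\<in>{1..}. lambert_term q e (k, r)) = of_int r ^ e / den 1 q r"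
      by (rule infsumI)
  qed
  finally show ?thesis .
qed

lemma infsum_odd_power_div_den:
  assumes "odd e"
  shows "(\<Sum>\<^sub>\<infinity>r::int. of_int r ^ e / den 1 q r) = 2 * lambert q e"
proof -
  let ?f = "\<lambda>r::int. of_int r ^ e / den 1 q r"
  have even: "?f (- r) = ?f r" for r using assms by (simp add: den_uminus)
  have "geo_bounded (\<lambda>r. of_int r ^ e * (1 / den 1 q r))"
    by (intro geo_bounded_int_power_mult geo_bounded_div_den[OF q, of 1 _ 1]) auto
  hence s: "?f summable_on UNIV" using geo_bounded_summable by fastforce
  have s': "?f summable_on A" for A by (rule summable_on_subset_banach[OF s]) simp
  have U: "(UNIV :: int set) = ({1..} \<union> {..-1}) \<union> {0}" by auto
  have "infsum ?f UNIV = infsum ?f ({1..} \<union> {..-1}) + infsum ?f {0}"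
    unfolding U by (rule infsum_Un_disjoint[OF s' s']) auto
  also have "infsum ?f ({1..} \<union> {..-1}) = infsum ?f {1..} + infsum ?f {..-1}"
    by (rule infsum_Un_disjoint[OF s' s']) auto
  also have "infsum ?f {..-1} = infsum (\<lambda>r. ?f (- r)) {1..}"
    by (rule infsum_reindex_bij_betw [symmetric]) (rule bij_betwI[of _ _ _ uminus], auto)
  also have "\<dots> = infsum ?f {1..}" by (simp only: even)
  also have "infsum ?f {0} = 0" by (simp add: den_def)
  finally show ?thesis by (simp add: lambert_eq)
qed

end

section \<open>The multiple series\<close>

text \<open>Writing \<open>fact (2 * i + 2)\<close> as \<open>2 * (i + 1) * fact (2 * i + 1)\<close>
  separates off \<open>2 ^ m * fact m\<close> and leaves a square.\<close>

lemma prod_hankel_diagonal: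
  "(\<Prod>i<m. c ^ Suc i * fact (2 * i + 2) * fact (2 * i + 1)) =
     (c :: complex) ^ (m * (m + 1) div 2) * 2 ^ m * fact m * (\<Prod>i=1..m. fact (2 * i - 1))\<^sup>2"
proof (induction m)
  case (Suc m)
  have e: "Suc m * (Suc m + 1) div 2 = m * (m + 1) div 2 + Suc m"
  proof -
    have "Suc m * (Suc m + 1) = m * (m + 1) + Suc m * 2" by simp
    thus ?thesis by (simp only: div_mult_self3) simp
  qed
  have f: "(fact (2 * m + 2) :: complex) = 2 * of_nat (Suc m) * fact (2 * m + 1)"
    by (simp add: algebra_simps)
  have P: "(\<Prod>i=1..Suc m. fact (2 * i - 1)) = (\<Prod>i=1..m. fact (2 * i - 1)) * (fact (2 * m + 1) :: complex)"
    by simp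
  have "(\<Prod>i<Suc m. c ^ Suc i * fact (2 * i + 2) * fact (2 * i + 1)) =
      c ^ (m * (m + 1) div 2) * 2 ^ m * fact m * (\<Prod>i=1..m. fact (2 * i - 1))\<^sup>2 *
      (c ^ Suc m * fact (2 * m + 2) * fact (2 * m + 1))"
    by (simp only: prod.lessThan_Suc Suc.IH)
  also have "\<dots> = (c ^ (m * (m + 1) div 2) * c ^ Suc m) * (2 ^ m * 2) * (of_nat (Suc m) * fact m) *
      ((\<Prod>i=1..m. fact (2 * i - 1)) * fact (2 * m + 1))\<^sup>2"
    unfolding f by (simp only: power2_eq_square mult_ac)
  also have "\<dots> = c ^ (Suc m * (Suc m + 1) div 2) * 2 ^ Suc m * fact (Suc m) * (\<Prod>i=1..Suc m. fact (2 * i - 1))\<^sup>2"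
    unfolding P e by (simp only: power_add power_Suc2 fact_Suc of_nat_mult)
  finally show ?case .
qed simp

lemma det_lambert:
  assumes q: "q \<noteq> 0" "norm q < 1"
  shows "det (mat m m (\<lambda>(i, j). lambert q (2 * (i + j) + 3))) =
    (q * triangle_series q ^ 8) ^ (m * (m + 1) div 2) * fact m * (\<Prod>i=1..m. fact (2 * i - 1))\<^sup>2"
proof -
  define Q where "Q = csqrt q"
  have Q2: "Q\<^sup>2 = q" by (simp add: Q_def)
  have Q: "Q \<noteq> 0" "norm Q < 1"
  proof -
    show "Q \<noteq> 0" using Q2 q by auto
    have "norm Q ^ 2 < 1" using q by (simp add: norm_power [symmetric] Q2)
    thus "norm Q < 1" by (simp add: power_less_one_iff)
  qed
  obtain \<phi> a c where \<phi>: "fps_nth \<phi> 0 = 0" "fps_nth (fps_deriv \<phi>) 0 = 0"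
    "fps_deriv \<phi> ^ 2 = 4 * \<phi> ^ 3 + fps_const a * \<phi> ^ 2 + 4 * fps_const c * \<phi>"
    "fps_deriv (fps_deriv \<phi>) = 6 * \<phi> ^ 2 + fps_const a * \<phi> + 2 * fps_const c"
    and coeff: "\<And>n. n > 0 \<Longrightarrow> fps_nth \<phi> n = fps_nth (fourier_fps (wp_coeff Q)) n"
    and c: "c = ((infsum (dn_coeff Q) UNIV ^ 2 - (\<Sum>\<^sub>\<infinity>n. alt n * dn_coeff Q n) ^ 2) / 4) ^ 2"
    using sn_squared_ode[OF Q] by blast
  have "c = ((dn_sum Q ^ 2 - dn_sum (- Q) ^ 2) / 4) ^ 2"
    unfolding c dn_sum_def by (simp only: dn_coeff_minus[abs_def])
  also have "\<dots> = Q\<^sup>2 * triangle_series q ^ 8"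
    unfolding dn_sum_square_diff[OF Q] by (simp add: power_mult_distrib Q2)
  finally have c': "c = q * triangle_series q ^ 8" by (simp add: Q2)
  have mom: "fact (2 * (n + 1)) * fps_nth \<phi> (2 * (n + 1)) = 2 * lambert q (2 * n + 3)" for n
  proof -
    let ?N = "2 * (n + 1)"
    let ?g = "\<lambda>r::int. fps_nth (fps_exp (of_int r / 2)) ?N * wp_coeff Q r"
    have "fps_nth \<phi> ?N = infsum ?g UNIV"
      by (rule coeff[unfolded fourier_fps_nth]) simp
    also have "\<dots> = infsum ?g (range (\<lambda>n. 2 * n))"
      by (rule infsum_cong_neutral) (auto simp: wp_coeff_def elim!: evenE)
    also have "\<dots> = (\<Sum>\<^sub>\<infinity>j. ?g (2 * j))"
      by (subst infsum_reindex) (simp add: inj_def, simp only: o_def)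
    also have "\<dots> = (\<Sum>\<^sub>\<infinity>j. 1 / fact ?N * (of_int j ^ (2 * n + 3) / den 1 q j))"
    proof (rule infsum_cong)
      fix j :: int
      \<comment> \<open>Only even frequencies \<open>2 * j\<close> occur. They turn the parameter
        \<open>Q\<close> into \<open>q\<close>, and the halved argument of the exponentials leaves
        plain powers of \<open>j\<close>.\<close>
      have "den 1 Q (2 * j) = den 1 q j"
        unfolding Q2 [symmetric] by (simp add: den_def square_powi)
      hence w: "wp_coeff Q (2 * j) = of_int j / den 1 q j" by (simp add: wp_coeff_def)
      have "fps_nth (fps_exp (of_int (2 * j) / 2 :: complex)) ?N = of_int j ^ ?N / fact ?N"
      proof -
        have "of_int (2 * j) / 2 = (of_int j :: complex)" by simp
        thus ?thesis by (simp only: fps_exp_nth of_nat_fact)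
      qed
      moreover have "of_int j ^ (2 * n + 3) = (of_int j ^ ?N * of_int j :: complex)"
        by (simp add: power_add eval_nat_numeral)
      ultimately show "?g (2 * j) = 1 / fact ?N * (of_int j ^ (2 * n + 3) / den 1 q j)"
        unfolding w by (simp only: times_divide_eq_left times_divide_eq_right mult_1_left divide_divide_eq_left mult_ac)
    qed
    also have "\<dots> = 1 / fact ?N * (2 * lambert q (2 * n + 3))"
      unfolding infsum_cmult_right' by (subst infsum_odd_power_div_den[OF q]) auto
    finally have *: "fps_nth \<phi> ?N = 1 / fact ?N * (2 * lambert q (2 * n + 3))" .
    have "y * (1 / y * z) = z" if "y \<noteq> 0" for y z :: complex using that by simp
    from this[OF fact_nonzero] show ?thesis unfolding * .
  qed
  have "mat m m (\<lambda>(i, j). fact (2 * (i + j + 1)) * fps_nth \<phi> (2 * (i + j + 1))) =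
      2 \<cdot>\<^sub>m mat m m (\<lambda>(i, j). lambert q (2 * (i + j) + 3))"
    unfolding mom by (rule eq_matI) simp_all
  hence "2 ^ m * det (mat m m (\<lambda>(i, j). lambert q (2 * (i + j) + 3))) =
      det (mat m m (\<lambda>(i, j). fact (2 * (i + j + 1)) * fps_nth \<phi> (2 * (i + j + 1))))"
    by simp
  also have "\<dots> = 2 ^ m * (c ^ (m * (m + 1) div 2) * fact m * (\<Prod>i=1..m. fact (2 * i - 1))\<^sup>2)"
    unfolding det_hankel_even_derivs[OF \<phi>] prod_hankel_diagonal by (simp only: mult_ac)
  finally show ?thesis by (simp add: c')
qed

lemma powi_sum:
  fixes q :: complex
  assumes "q \<noteq> 0"
  shows "q powi (\<Sum>j\<in>A. f j) = (\<Prod>j\<in>A. q powi f j)"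
  by (induction A rule: infinite_finite_induct) (simp_all add: power_int_add assms)

lemma prod_pairs_eq_vandermonde:
  fixes r :: "nat \<Rightarrow> int"
  shows "(\<Prod>(i, j)\<in>{(i, j). 1 \<le> i \<and> i < j \<and> j \<le> m}. (r i - r j)\<^sup>2 * (r i + r j)\<^sup>2) =
    (\<Prod>j<m. \<Prod>i<j. (r (Suc j))\<^sup>2 - (r (Suc i))\<^sup>2)\<^sup>2"
proof -
  have "(\<Prod>j<m. \<Prod>i<j. (r (Suc j))\<^sup>2 - (r (Suc i))\<^sup>2)\<^sup>2 =
      (\<Prod>(j, i)\<in>Sigma {..<m} (\<lambda>j. {..<j}). ((r (Suc j))\<^sup>2 - (r (Suc i))\<^sup>2)\<^sup>2)"
    by (subst prod.Sigma) (simp_all add: prod_power_distrib case_prod_unfold)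
  also have "\<dots> = (\<Prod>(i, j)\<in>{(i, j). 1 \<le> i \<and> i < j \<and> j \<le> m}. (r i - r j)\<^sup>2 * (r i + r j)\<^sup>2)"
  proof (rule prod.reindex_bij_witness[where i = "\<lambda>(i, j). (j - 1, i - 1)" and j = "\<lambda>(j, i). (Suc i, Suc j)"])
    fix x :: "nat \<times> nat"
    obtain j i where x: "x = (j, i)" by fastforce
    have "(r (Suc i) - r (Suc j))\<^sup>2 * (r (Suc i) + r (Suc j))\<^sup>2 = ((r (Suc j))\<^sup>2 - (r (Suc i))\<^sup>2)\<^sup>2"
      by (simp add: power2_eq_square algebra_simps)
    thus "(case (case x of (j, i) \<Rightarrow> (Suc i, Suc j)) of (i, j) \<Rightarrow> (r i - r j)\<^sup>2 * (r i + r j)\<^sup>2) =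
       (case x of (j, i) \<Rightarrow> ((r (Suc j))\<^sup>2 - (r (Suc i))\<^sup>2)\<^sup>2)"
      by (simp add: x)
  qed auto
  finally show ?thesis ..
qed

text \<open>The product over pairs is the squared Vandermonde determinant in the \<open>r i\<close>
  squared; expanding both factors makes every summand a product over coordinates, with exponent
  \<open>3 + 2 * s + 2 * t\<close>. The permutations act on \<open>{0..<m}\<close>, hence the
  \<open>j - 1\<close>.\<close>

lemma kr_term_eq_sum_perms:
  assumes q: "q \<noteq> 0"
  shows "kr_term m q k r = (\<Sum>(s, t)\<in>perms m \<times> perms m.
    q powi (- int (m * (m + 1) div 2)) * (signof s * signof t) *
      (\<Prod>j=1..m. lambert_term q (2 * (s (j - 1) + t (j - 1)) + 3) (k j, r j)))"
proof -
  define x where "x = (\<lambda>i. (of_int (r (Suc i)) :: complex)\<^sup>2)"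
  define K where "K = q powi (- int (m * (m + 1) div 2))"
  define T where "T = (\<lambda>s. signof s * (\<Prod>i<m. x i ^ s i) :: complex)"
  define G where "G = (\<Prod>i<m. q powi ((2 * k (Suc i) - 1) * r (Suc i)) * of_int (r (Suc i)) ^ 3)"
  have "(\<Prod>j<m. \<Prod>i<j. x j - x i) = (\<Sum>s\<in>perms m. T s)"
    using det_vandermonde[of m x] det_Leibniz[of m "\<lambda>i j. x i ^ j"] by (simp add: T_def)
  hence V: "(\<Prod>j<m. \<Prod>i<j. x j - x i)\<^sup>2 = (\<Sum>(s, t)\<in>perms m \<times> perms m. T s * T t)"
    by (simp only: power2_eq_square sum_product sum.cartesian_product)
  have kr: "kr_term m q k r = K * (G * (\<Prod>j<m. \<Prod>i<j. x j - x i)\<^sup>2)"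
  proof -
    have "(\<Sum>j=1..m. 2 * k j * r j - r j) - int (m * (m + 1) div 2) =
        - int (m * (m + 1) div 2) + (\<Sum>i<m. (2 * k (Suc i) - 1) * r (Suc i))"
      by (simp add: prod.atLeast1_atMost_eq sum.atLeast1_atMost_eq left_diff_distrib)
    hence "q powi ((\<Sum>j=1..m. 2 * k j * r j - r j) - int (m * (m + 1) div 2)) =
        K * (\<Prod>i<m. q powi ((2 * k (Suc i) - 1) * r (Suc i)))"
      unfolding K_def by (simp only: power_int_add[OF disjI1[OF q]] powi_sum[OF q])
    moreover have "of_int ((\<Prod>i=1..m. r i ^ 3) *
        (\<Prod>(i, j)\<in>{(i, j). 1 \<le> i \<and> i < j \<and> j \<le> m}. (r i - r j)\<^sup>2 * (r i + r j)\<^sup>2)) =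
        (\<Prod>i<m. of_int (r (Suc i)) ^ 3 :: complex) * (\<Prod>j<m. \<Prod>i<j. x j - x i)\<^sup>2"
      unfolding prod_pairs_eq_vandermonde by (simp add: x_def prod.atLeast1_atMost_eq)
    ultimately show ?thesis
      unfolding kr_term_def G_def prod.distrib by (simp only: mult_ac)
  qed
  have "K * (G * (T s * T t)) = K * (signof s * signof t) *
      (\<Prod>j=1..m. lambert_term q (2 * (s (j - 1) + t (j - 1)) + 3) (k j, r j))" for s t
  proof -
    have "(\<Prod>j=1..m. lambert_term q (2 * (s (j - 1) + t (j - 1)) + 3) (k j, r j)) =
        G * (\<Prod>i<m. x i ^ s i) * (\<Prod>i<m. x i ^ t i)"
    proof -
      have "(\<Prod>j=1..m. lambert_term q (2 * (s (j - 1) + t (j - 1)) + 3) (k j, r j)) =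
          (\<Prod>i<m. lambert_term q (2 * (s i + t i) + 3) (k (Suc i), r (Suc i)))"
        by (simp add: prod.atLeast1_atMost_eq)
      also have "\<dots> = G * (\<Prod>i<m. x i ^ s i) * (\<Prod>i<m. x i ^ t i)"
        unfolding G_def prod.distrib [symmetric]
      proof (rule prod.cong)
        fix i
        have "y ^ (2 * (s i + t i) + 3) = y ^ 3 * (y\<^sup>2) ^ s i * (y\<^sup>2) ^ t i" for y :: complex
          by (simp only: power_add distrib_left power_mult) (simp only: mult_ac)
        thus "lambert_term q (2 * (s i + t i) + 3) (k (Suc i), r (Suc i)) =
            q powi ((2 * k (Suc i) - 1) * r (Suc i)) * of_int (r (Suc i)) ^ 3 * x i ^ s i * x i ^ t i"
          by (simp only: lambert_term_def prod.case x_def mult.assoc)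
      qed simp
      finally show ?thesis .
    qed
    thus ?thesis by (simp only: T_def mult_ac)
  qed
  hence "(\<Sum>(s, t)\<in>perms m \<times> perms m. K * (G * (T s * T t))) =
      (\<Sum>(s, t)\<in>perms m \<times> perms m. K * (signof s * signof t) *
        (\<Prod>j=1..m. lambert_term q (2 * (s (j - 1) + t (j - 1)) + 3) (k j, r j)))"
    by (simp only:)
  thus ?thesis unfolding kr V K_def by (simp only: sum_distrib_left case_prod_unfold)
qed

lemma int_vecs_eq_PiE:
  assumes "J \<subseteq> {1..m}"
  shows "int_vecs m J = PiE {1..m} (\<lambda>j. if j \<in> J then {..0} else {1..})"
proof (intro equalityI subsetI)
  fix k assume "k \<in> int_vecs m J"
  thus "k \<in> PiE {1..m} (\<lambda>j. if j \<in> J then {..0} else {1..})"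
    by (auto simp: int_vecs_def PiE_iff)
next
  fix k :: "nat \<Rightarrow> int" assume k: "k \<in> PiE {1..m} (\<lambda>j. if j \<in> J then {..0} else {1..})"
  have "j \<in> J \<longleftrightarrow> k j \<le> 0" if "j \<in> {1..m}" for j
    using PiE_mem[OF k that] by (auto split: if_splits)
  thus "k \<in> int_vecs m J" using k assms by (auto simp: int_vecs_def PiE_iff)
qed

lemma bij_betw_PiE_pair:
  "bij_betw (\<lambda>g. (\<lambda>j\<in>I. fst (g j), \<lambda>j\<in>I. snd (g j))) (PiE I (\<lambda>j. A j \<times> B j)) (PiE I A \<times> PiE I B)"
proof (rule bij_betwI[of _ _ _ "\<lambda>(k, r). \<lambda>j\<in>I. (k j, r j)"])
  show "(case (\<lambda>j\<in>I. fst (g j), \<lambda>j\<in>I. snd (g j)) of (k, r) \<Rightarrow> \<lambda>j\<in>I. (k j, r j)) = g"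
    if "g \<in> PiE I (\<lambda>j. A j \<times> B j)" for g
    using that by (auto simp: fun_eq_iff PiE_iff extensional_def restrict_def)
  show "(\<lambda>j\<in>I. fst ((case x of (k, r) \<Rightarrow> \<lambda>j\<in>I. (k j, r j)) j),
         \<lambda>j\<in>I. snd ((case x of (k, r) \<Rightarrow> \<lambda>j\<in>I. (k j, r j)) j)) = x"
    if "x \<in> PiE I A \<times> PiE I B" for x
    using that by (auto simp: fun_eq_iff PiE_iff extensional_def restrict_def)
qed (auto simp: PiE_iff mem_Times_iff)

lemma abs_summable_prod_PiE:
  fixes f :: "'a \<Rightarrow> 'b :: countable \<Rightarrow> complex"
  assumes "finite A" "\<And>x. x \<in> A \<Longrightarrow> f x abs_summable_on B x"
  shows "(\<lambda>g. \<Prod>x\<in>A. f x (g x)) abs_summable_on PiE A B"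
  unfolding abs_summable_equivalent
  by (rule abs_summable_on_prod_PiE) (use assms in \<open>auto simp: abs_summable_equivalent [symmetric]\<close>)

text \<open>Turning pairs of vectors into vectors of pairs makes the region a product of quadrants,
  over which each summand factors. A coordinate in \<open>J\<close> contributes minus the Lambert
  series, any other one the series itself, so \<open>J\<close> enters only through a sign.\<close>

lemma infsum_kr_term:
  assumes q: "q \<noteq> 0" "norm q < 1" and J: "J \<subseteq> {1..m}"
  shows "(\<lambda>(k, r). kr_term m q k r) abs_summable_on int_vecs m J \<times> int_vecs m J" (is ?thesis1)
    and "(\<Sum>\<^sub>\<infinity>(k, r)\<in>int_vecs m J \<times> int_vecs m J. kr_term m q k r) =
      (- 1) ^ card J * (q powi (- int (m * (m + 1) div 2)) *
        (\<Sum>(s, t)\<in>perms m \<times> perms m. signof s * signof t * (\<Prod>i<m. lambert q (2 * (s i + t i) + 3))))"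
      (is ?thesis2)
proof -
  define A :: "nat \<Rightarrow> int set" where "A = (\<lambda>j. if j \<in> J then {..0} else {1..})"
  define h where "h = (\<lambda>g :: nat \<Rightarrow> int \<times> int. (\<lambda>j\<in>{1..m}. fst (g j), \<lambda>j\<in>{1..m}. snd (g j)))"
  define P where "P = PiE {1..m} (\<lambda>j. A j \<times> A j)"
  define K where "K = q powi (- int (m * (m + 1) div 2))"
  define e where "e = (\<lambda>(st :: (nat \<Rightarrow> nat) \<times> (nat \<Rightarrow> nat)) j. 2 * (fst st (j - 1) + snd st (j - 1)) + 3)"
  define c where "c = (\<lambda>st :: (nat \<Rightarrow> nat) \<times> (nat \<Rightarrow> nat). K * (signof (fst st) * signof (snd st)))"
  define F where "F = (\<lambda>st g. c st * (\<Prod>j=1..m. lambert_term q (e st j) (g j)))"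
  have iv: "int_vecs m J = PiE {1..m} A" unfolding A_def by (rule int_vecs_eq_PiE[OF J])
  have bij: "bij_betw h P (int_vecs m J \<times> int_vecs m J)"
    unfolding h_def P_def iv by (rule bij_betw_PiE_pair)
  have fin: "finite (perms m \<times> perms m)" by (simp add: finite_permutations)
  have kr: "(case h g of (k, r) \<Rightarrow> kr_term m q k r) = (\<Sum>st\<in>perms m \<times> perms m. F st g)" for g
  proof -
    have "(\<Prod>j=1..m. lambert_term q (e st j) ((\<lambda>j\<in>{1..m}. fst (g j)) j, (\<lambda>j\<in>{1..m}. snd (g j)) j)) =
        (\<Prod>j=1..m. lambert_term q (e st j) (g j))" for st
      by (intro prod.cong) auto
    thus ?thesis
      unfolding h_def prod.case kr_term_eq_sum_perms[OF q(1)] F_def c_def K_def e_def case_prod_unfold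
      by (simp only: fst_conv snd_conv)
  qed
  have ab: "lambert_term q (e st j) abs_summable_on A j \<times> A j" for st j
    using abs_summable_lambert_pos[OF q] lambert_neg(1)[OF q] by (auto simp: A_def e_def)
  have abF: "F st abs_summable_on P" for st
  proof -
    have "(\<lambda>g. \<Prod>j=1..m. lambert_term q (e st j) (g j)) abs_summable_on P"
      unfolding P_def by (rule abs_summable_prod_PiE) (simp, rule ab)
    hence "(\<lambda>g. norm (c st) * norm (\<Prod>j=1..m. lambert_term q (e st j) (g j))) summable_on P"
      by (rule summable_on_cmult_right)
    thus ?thesis unfolding F_def norm_mult .
  qed
  have sF: "infsum (F st) P = (- 1) ^ card J * (c st * (\<Prod>i<m. lambert q (2 * (fst st i + snd st i) + 3)))" for st
  proof -
    have "infsum (F st) P = c st * infsum (\<lambda>g. \<Prod>j=1..m. lambert_term q (e st j) (g j)) P"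
      unfolding F_def by (rule infsum_cmult_right')
    also have "infsum (\<lambda>g. \<Prod>j=1..m. lambert_term q (e st j) (g j)) P =
        (\<Prod>j=1..m. infsum (lambert_term q (e st j)) (A j \<times> A j))"
      unfolding P_def by (rule infsum_prod_PiE_abs) (simp, rule ab)
    also have "\<dots> = (\<Prod>j=1..m. (if j \<in> J then - 1 else 1) * lambert q (e st j))"
    proof (rule prod.cong)
      fix j
      have "odd (e st j)" by (simp add: e_def)
      thus "infsum (lambert_term q (e st j)) (A j \<times> A j) = (if j \<in> J then - 1 else 1) * lambert q (e st j)"
        using lambert_neg(2)[OF q, of "e st j"] by (simp add: A_def lambert_def)
    qed simp
    also have "\<dots> = (\<Prod>j=1..m. if j \<in> J then - 1 else 1) * (\<Prod>j=1..m. lambert q (e st j))"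
      by (rule prod.distrib)
    also have "(\<Prod>j=1..m. if j \<in> J then - 1 else 1) = (- 1 :: complex) ^ card J"
      using J by (simp add: prod.If_cases Int_absorb1)
    also have "(\<Prod>j=1..m. lambert q (e st j)) = (\<Prod>i<m. lambert q (2 * (fst st i + snd st i) + 3))"
      by (simp add: prod.atLeast1_atMost_eq e_def)
    finally show ?thesis by (simp only: mult_ac)
  qed
  have "(\<lambda>g. \<Sum>st\<in>perms m \<times> perms m. F st g) abs_summable_on P"
    by (rule infsum_sum(1)[OF fin]) (rule abF)
  hence "(\<lambda>g. norm (case h g of (k, r) \<Rightarrow> kr_term m q k r)) summable_on P"
    unfolding kr .
  thus ?thesis1
    by (subst (asm) summable_on_reindex_bij_betw[OF bij, of "\<lambda>x. norm (case x of (k, r) \<Rightarrow> kr_term m q k r)"])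
  have "(\<Sum>\<^sub>\<infinity>(k, r)\<in>int_vecs m J \<times> int_vecs m J. kr_term m q k r) =
      (\<Sum>\<^sub>\<infinity>g\<in>P. case h g of (k, r) \<Rightarrow> kr_term m q k r)"
    by (rule infsum_reindex_bij_betw[OF bij, symmetric])
  also have "\<dots> = (\<Sum>\<^sub>\<infinity>g\<in>P. \<Sum>st\<in>perms m \<times> perms m. F st g)"
    unfolding kr ..
  also have "\<dots> = (\<Sum>st\<in>perms m \<times> perms m. infsum (F st) P)"
    by (rule infsum_sum(2)[OF fin]) (rule abF)
  finally show ?thesis2
    unfolding sF c_def K_def by (simp only: sum_distrib_left case_prod_unfold mult.assoc)
qed

text \<open>The sign in front cancels the one from the reflections, so all \<open>2 ^ m\<close> sets
  \<open>J\<close> contribute equally. One \<open>fact m\<close> comes from the pairs of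
  permutations, the other from the Hankel determinant.\<close>

lemma triangle_power_nonzero_nome:
  assumes q: "q \<noteq> 0" "norm q < 1"
  shows "triangle_series q ^ (4 * m\<^sup>2 + 4 * m) =
      1 / (2 ^ m * (fact m)\<^sup>2 * (\<Prod>i=1..m. fact (2 * i - 1))\<^sup>2) *
      (\<Sum>J\<in>Pow {1..m}. (- 1) ^ card J *
         (\<Sum>\<^sub>\<infinity>(k, r)\<in>int_vecs m J \<times> int_vecs m J. kr_term m q k r))"
proof -
  define N where "N = m * (m + 1) div 2"
  define D where "D = (\<Prod>i=1..m. fact (2 * i - 1) :: complex)"
  define X where "X = (\<Sum>(s, t)\<in>perms m \<times> perms m. signof s * signof t * (\<Prod>i<m. lambert q (2 * (s i + t i) + 3)))"
  have N2: "2 * N = m * (m + 1)" unfolding N_def by (rule dvd_mult_div_cancel) simp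
  have "(\<Sum>J\<in>Pow {1..m}. (- 1) ^ card J *
         (\<Sum>\<^sub>\<infinity>(k, r)\<in>int_vecs m J \<times> int_vecs m J. kr_term m q k r)) =
      (\<Sum>J\<in>Pow {1..m}. q powi (- int N) * X)"
  proof (rule sum.cong)
    fix J assume "J \<in> Pow {1..m}"
    hence J: "J \<subseteq> {1..m}" by simp
    have "(- 1) ^ card J * ((- 1) ^ card J * y) = y" for y :: complex
      by (simp add: mult.assoc [symmetric] power_mult_distrib [symmetric])
    thus "(- 1) ^ card J * (\<Sum>\<^sub>\<infinity>(k, r)\<in>int_vecs m J \<times> int_vecs m J. kr_term m q k r) = q powi (- int N) * X"
      unfolding infsum_kr_term(2)[OF q J] X_def N_def by (simp only:)
  qed simp
  also have "\<dots> = 2 ^ m * (q powi (- int N) * X)"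
    by (simp add: card_Pow)
  also have "X = fact m * ((q * triangle_series q ^ 8) ^ N * fact m * D\<^sup>2)"
    unfolding X_def sum_perms_pairs_eq_fact_det[of "\<lambda>n. lambert q (2 * n + 3)"] det_lambert[OF q] N_def D_def ..
  also have "q powi (- int N) * (fact m * ((q * triangle_series q ^ 8) ^ N * fact m * D\<^sup>2)) =
      (fact m)\<^sup>2 * D\<^sup>2 * triangle_series q ^ (8 * N)"
    using q by (simp add: power_int_minus power_mult_distrib power_mult [symmetric] power2_eq_square[of "fact m"])
  also have "8 * N = 4 * m\<^sup>2 + 4 * m" using N2 by (simp add: power2_eq_square algebra_simps)
  finally have *: "(\<Sum>J\<in>Pow {1..m}. (- 1) ^ card J *
         (\<Sum>\<^sub>\<infinity>(k, r)\<in>int_vecs m J \<times> int_vecs m J. kr_term m q k r)) =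
      2 ^ m * ((fact m)\<^sup>2 * D\<^sup>2 * triangle_series q ^ (4 * m\<^sup>2 + 4 * m))" .
  have "D \<noteq> 0" by (simp add: D_def)
  thus ?thesis unfolding * D_def [symmetric] by simp
qed

section \<open>Polynomial terms and continuity at q = 0\<close>

lemma triangular_le_sum_pos_nats:
  fixes A :: "nat set"
  assumes "finite A" "0 \<notin> A"
  shows "card A * (card A + 1) div 2 \<le> \<Sum>A"
  using assms
proof (induction "card A" arbitrary: A)
  case (Suc n)
  define M where "M = Max A"
  have "A \<noteq> {}" using Suc by auto
  hence M: "M \<in> A" using Suc.prems by (simp add: M_def)
  have "A \<subseteq> {1..M}"
  proof
    fix x assume x: "x \<in> A"
    hence "x \<noteq> 0" using Suc.prems by metis
    thus "x \<in> {1..M}" using x Suc.prems by (simp add: M_def)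
  qed
  hence "card A \<le> M" using card_mono[of "{1..M}" A] by simp
  moreover have "n = card (A - {M})" using Suc.hyps(2) M Suc.prems by simp
  with Suc.hyps(1)[OF this] Suc.prems have "n * (n + 1) div 2 \<le> \<Sum>(A - {M})" by simp
  moreover have "\<Sum>A = M + \<Sum>(A - {M})" using Suc.prems(1) M by (rule sum.remove)
  moreover have "Suc n * (Suc n + 1) div 2 = n * (n + 1) div 2 + Suc n"
  proof -
    have "Suc n * (Suc n + 1) = n * (n + 1) + Suc n * 2" by simp
    thus ?thesis by (simp only: div_mult_self3) simp
  qed
  ultimately show ?case unfolding Suc.hyps(2) [symmetric] by linarith
qed simp

text \<open>When the coefficient is nonzero, the \<open>\<bar>r j\<bar>\<close> are distinct and
  positive, so their sum is at least the triangular number subtracted in the exponent. Every term is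
  therefore continuous at 0 and its norm increases with \<open>norm q\<close>.\<close>

lemma kr_term_monomial:
  assumes k: "k \<in> int_vecs m J" and r: "r \<in> int_vecs m J"
  obtains c n where "\<And>q. kr_term m q k r = q ^ n * c"
proof -
  define c where "c = (\<Prod>i=1..m. r i ^ 3) *
             (\<Prod>(i, j)\<in>{(i, j). 1 \<le> i \<and> i < j \<and> j \<le> m}. (r i - r j)\<^sup>2 * (r i + r j)\<^sup>2)"
  define e where "e = (\<Sum>j=1..m. 2 * k j * r j - r j) - int (m * (m + 1) div 2)"
  have kr: "kr_term m q k r = q powi e * of_int c" for q
    unfolding kr_term_def e_def c_def ..
  show ?thesis
  proof (cases "c = 0")
    case True
    thus ?thesis using that[of 0 0] by (simp add: kr)
  next
    case False
    have fin: "finite {(i, j). 1 \<le> i \<and> i < j \<and> j \<le> m}"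
      by (rule finite_subset[of _ "{..m} \<times> {..m}"]) auto
    have nz: "r i \<noteq> 0" if "i \<in> {1..m}" for i
      using False that by (auto simp: c_def)
    have lt: "\<bar>r i\<bar> \<noteq> \<bar>r j\<bar>" if "1 \<le> i" "i < j" "j \<le> m" for i j
    proof
      assume "\<bar>r i\<bar> = \<bar>r j\<bar>"
      hence "(r i - r j)\<^sup>2 * (r i + r j)\<^sup>2 = 0" by (auto simp: abs_eq_iff)
      hence "(\<Prod>(i, j)\<in>{(i, j). 1 \<le> i \<and> i < j \<and> j \<le> m}. (r i - r j)\<^sup>2 * (r i + r j)\<^sup>2) = 0"
        using that by (intro prod_zero[OF fin] bexI[of _ "(i, j)"]) auto
      thus False using False by (simp add: c_def)
    qed
    define a where "a = (\<lambda>j. nat \<bar>r j\<bar>)"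
    have inj: "inj_on a {1..m}"
    proof (rule inj_onI)
      fix i j assume ij: "i \<in> {1..m}" "j \<in> {1..m}" "a i = a j"
      hence "\<bar>r i\<bar> = \<bar>r j\<bar>" by (simp add: a_def)
      thus "i = j" using lt[of i j] lt[of j i] ij by (cases i j rule: linorder_cases) auto
    qed
    have "m * (m + 1) div 2 \<le> \<Sum>(a ` {1..m})"
    proof -
      have "0 \<notin> a ` {1..m}" using nz by (auto simp: a_def)
      from triangular_le_sum_pos_nats[OF _ this] show ?thesis by (simp add: card_image[OF inj, simplified])
    qed
    also have "\<dots> = (\<Sum>j=1..m. a j)" by (simp only: sum.reindex[OF inj] o_def)
    finally have "int (m * (m + 1) div 2) \<le> int (\<Sum>j=1..m. a j)" by (simp only: of_nat_le_iff)
    also have "\<dots> = (\<Sum>j=1..m. \<bar>r j\<bar>)" by (simp add: a_def)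
    also have "\<dots> \<le> (\<Sum>j=1..m. 2 * k j * r j - r j)"
    proof (rule sum_mono)
      fix j assume j: "j \<in> {1..m}"
      \<comment> \<open>Membership in the same \<open>int_vecs m J\<close> ties the signs together,
        so \<open>(2 * k j - 1) * r j\<close> is at least \<open>\<bar>r j\<bar>\<close>.\<close>
      have "k j \<le> 0 \<longleftrightarrow> r j \<le> 0" using k r j by (auto simp: int_vecs_def)
      hence "1 \<le> 2 * k j - 1 \<and> 0 < r j \<or> 2 * k j - 1 \<le> - 1 \<and> r j \<le> 0" by linarith
      hence "\<bar>r j\<bar> \<le> (2 * k j - 1) * r j"
      proof
        assume "1 \<le> 2 * k j - 1 \<and> 0 < r j"
        thus ?thesis using mult_right_mono[of 1 "2 * k j - 1" "r j"] by simp
      next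
        assume "2 * k j - 1 \<le> - 1 \<and> r j \<le> 0"
        thus ?thesis using mult_right_mono_neg[of "2 * k j - 1" "- 1" "r j"] by simp
      qed
      thus "\<bar>r j\<bar> \<le> 2 * k j * r j - r j" by (simp add: left_diff_distrib)
    qed
    finally have "0 \<le> e" by (simp add: e_def)
    hence "kr_term m q k r = q ^ nat e * of_int c" for q by (simp add: kr power_int_def)
    thus ?thesis by (rule that)
  qed
qed

lemma norm_kr_term_mono:
  assumes "k \<in> int_vecs m J" "r \<in> int_vecs m J" "norm p \<le> norm q"
  shows "norm (kr_term m p k r) \<le> norm (kr_term m q k r)"
proof -
  obtain c n where "\<And>q. kr_term m q k r = q ^ n * c" using kr_term_monomial[OF assms(1,2)] by metis
  thus ?thesis using assms(3)
    by (auto simp: norm_mult norm_power intro!: mult_right_mono power_mono)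
qed

lemma continuous_on_kr_term:
  assumes "k \<in> int_vecs m J" "r \<in> int_vecs m J"
  shows "continuous_on S (\<lambda>q. kr_term m q k r)"
proof -
  obtain c n where "\<And>q. kr_term m q k r = q ^ n * c" using kr_term_monomial[OF assms] by metis
  thus ?thesis by (auto intro!: continuous_intros)
qed

text \<open>The terms at \<open>q = 1 / 2\<close> form one summable majorant for the whole closed
  disc of that radius, including its centre.\<close>

lemma kr_term_dominated:
  assumes "J \<subseteq> {1..m}"
  shows "(\<lambda>x. norm (case x of (k, r) \<Rightarrow> kr_term m (1 / 2) k r)) summable_on int_vecs m J \<times> int_vecs m J"
  by (rule infsum_kr_term(1)[OF _ _ assms]) (auto simp: norm_divide)

lemma continuous_on_infsum_kr_term:
  assumes J: "J \<subseteq> {1..m}"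
  shows "continuous_on (cball 0 (1 / 2))
    (\<lambda>q. \<Sum>\<^sub>\<infinity>(k, r)\<in>int_vecs m J \<times> int_vecs m J. kr_term m q k r)"
proof (rule uniform_limit_theorem)
  let ?X = "int_vecs m J \<times> int_vecs m J"
  show "uniform_limit (cball 0 (1 / 2)) (\<lambda>F q. \<Sum>x\<in>F. case x of (k, r) \<Rightarrow> kr_term m q k r)
     (\<lambda>q. \<Sum>\<^sub>\<infinity>(k, r)\<in>?X. kr_term m q k r) (finite_subsets_at_top ?X)"
  proof (rule Weierstrass_m_test_general[OF _ kr_term_dominated[OF J]])
    fix x :: "(nat \<Rightarrow> int) \<times> (nat \<Rightarrow> int)" and q :: complex
    assume "x \<in> ?X" "q \<in> cball 0 (1 / 2)"
    thus "norm (case x of (k, r) \<Rightarrow> kr_term m q k r) \<le> norm (case x of (k, r) \<Rightarrow> kr_term m (1 / 2) k r)"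
      by (auto intro!: norm_kr_term_mono simp: norm_divide)
  qed
  show "\<forall>\<^sub>F F in finite_subsets_at_top ?X.
      continuous_on (cball 0 (1 / 2)) (\<lambda>q. \<Sum>x\<in>F. case x of (k, r) \<Rightarrow> kr_term m q k r)"
  proof (rule eventually_finite_subsets_at_top_weakI)
    fix F assume F: "finite F" "F \<subseteq> ?X"
    show "continuous_on (cball 0 (1 / 2)) (\<lambda>q. \<Sum>x\<in>F. case x of (k, r) \<Rightarrow> kr_term m q k r)"
    proof (rule continuous_on_sum)
      fix x assume "x \<in> F"
      thus "continuous_on (cball 0 (1 / 2)) (\<lambda>q. case x of (k, r) \<Rightarrow> kr_term m q k r)"
        using F continuous_on_kr_term by (cases x) auto
    qed
  qed
qed simp

lemma continuous_on_triangle_series: "continuous_on (cball 0 (1 / 2)) triangle_series"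
  unfolding triangle_series_def [abs_def]
proof (rule uniform_limit_theorem)
  show "uniform_limit (cball 0 (1 / 2)) (\<lambda>n q. \<Sum>i<n. q ^ (i * (i + 1) div 2))
     (\<lambda>q :: complex. \<Sum>i. q ^ (i * (i + 1) div 2)) sequentially"
  proof (rule Weierstrass_m_test[where M = "\<lambda>i. (1 / 2) ^ i"])
    fix n :: nat and q :: complex assume "q \<in> cball 0 (1 / 2)"
    hence q: "norm q \<le> 1 / 2" by simp
    have "n * 2 \<le> n * (n + 1)" by (cases n) auto
    hence "n * 2 div 2 \<le> n * (n + 1) div 2" by (rule div_le_mono)
    hence "n \<le> n * (n + 1) div 2" by (simp only: nonzero_mult_div_cancel_right)
    hence "norm q ^ (n * (n + 1) div 2) \<le> norm q ^ n"
      using q by (intro power_decreasing) auto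
    also have "\<dots> \<le> (1 / 2) ^ n" using q by (intro power_mono) auto
    finally show "norm (q ^ (n * (n + 1) div 2)) \<le> (1 / 2) ^ n" by (simp add: norm_power)
  qed (simp add: summable_geometric)
qed (auto intro!: always_eventually continuous_intros)

theorem theorem5p20:
  fixes m :: nat and q :: complex
  assumes "m \<ge> 1" and "norm q < 1"
  shows "(\<forall>J\<in>Pow {1..m}. (\<lambda>(k, r). kr_term m q k r) summable_on (int_vecs m J \<times> int_vecs m J)) \<and>
    triangle_series q ^ (4 * m\<^sup>2 + 4 * m) =
      1 / (2 ^ m * (fact m)\<^sup>2 * (\<Prod>i=1..m. fact (2 * i - 1))\<^sup>2) *
      (\<Sum>J\<in>Pow {1..m}. (- 1) ^ card J *
         (\<Sum>\<^sub>\<infinity>(k, r)\<in>int_vecs m J \<times> int_vecs m J. kr_term m q k r))"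
proof (cases "q = 0")
  case False
  have "(\<lambda>(k, r). kr_term m q k r) summable_on (int_vecs m J \<times> int_vecs m J)" if "J \<in> Pow {1..m}" for J
    using that by (intro abs_summable_summable[OF infsum_kr_term(1)[OF False assms(2)]]) auto
  thus ?thesis using triangle_power_nonzero_nome[OF False assms(2)] by blast
next
  case True
  let ?S = "cball 0 (1 / 2) :: complex set"
  have "(\<lambda>(k, r). kr_term m q k r) summable_on (int_vecs m J \<times> int_vecs m J)" if "J \<in> Pow {1..m}" for J
  proof -
    have "(\<lambda>(k, r). kr_term m q k r) abs_summable_on (int_vecs m J \<times> int_vecs m J)"
      by (rule summable_on_comparison_test[OF kr_term_dominated[of J]])
         (use that True in \<open>auto intro!: norm_kr_term_mono\<close>)
    thus ?thesis by (rule abs_summable_summable)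
  qed
  moreover have "triangle_series 0 ^ (4 * m\<^sup>2 + 4 * m) =
      1 / (2 ^ m * (fact m)\<^sup>2 * (\<Prod>i=1..m. fact (2 * i - 1))\<^sup>2) *
      (\<Sum>J\<in>Pow {1..m}. (- 1) ^ card J *
         (\<Sum>\<^sub>\<infinity>(k, r)\<in>int_vecs m J \<times> int_vecs m J. kr_term m 0 k r))" (is "?L 0 = ?R 0")
  proof (rule tendsto_unique)
    show "at (0 :: complex) within ?S \<noteq> bot"
      by (subst at_within_interior) auto
    have "continuous_on ?S ?L"
      by (intro continuous_intros continuous_on_triangle_series)
    thus "(?L \<longlongrightarrow> ?L 0) (at 0 within ?S)" by (auto simp: continuous_on_def)
    have "continuous_on ?S ?R"
      by (intro continuous_intros continuous_on_infsum_kr_term) auto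
    hence "(?R \<longlongrightarrow> ?R 0) (at 0 within ?S)" by (auto simp: continuous_on_def)
    moreover have "\<forall>\<^sub>F q in at 0 within ?S. ?R q = ?L q"
      unfolding eventually_at_filter
      by (rule always_eventually) (use triangle_power_nonzero_nome[of _ m] in auto)
    ultimately show "(?L \<longlongrightarrow> ?R 0) (at 0 within ?S)"
      by (rule Lim_transform_eventually)
  qed
  ultimately show ?thesis unfolding True by blast
qed

end
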